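(* Let $H$ be a Hilbert space, let $\mathcal{A}\subset L(H)$ be a commutative $C^*$-subalgebra with $1\in\mathcal{A}$, and let $U\in L(H)$ be such that $\delta(a)=UaU^*$ is an endomorphism of $\mathcal{A}$ and $U^*U\in\mathcal{A}'$. Let $\alpha:\Delta\to M(\mathcal{A})$ be the partial mapping associated with $\delta$, and $\Delta_n$ the domains of its iterates. Put $$M_N=\{\widetilde{x}=(x_0,x_1,\dots,x_N,0,0,\dots):\ x_n\in\Delta_n\ (0\le n\le N),\ \alpha(x_n)=x_{n-1},\ n=1,\dots,N\},\qquad N=0,1,2,\dots,$$ $$M_\infty=\{\widetilde{x}=(x_0,x_1,\dots):\ x_n\in\Delta_n\ (n\ge 0),\ \alpha(x_n)=x_{n-1},\ n\ge 1\}.$$ Equip the disjoint union $\bigcup_{N=0}^\infty M_N\cup M_\infty$ with the topology in which a base of neighborhoods of a point $\widetilde{x}\in M_N$ is given by the sets $$O(a_1,\dots,a_k,\varepsilon)=\{\widetilde{y}\in M_N:\ |a_i(x_N)-a_i(y_N)|<\varepsilon,\ i=1,\dots,k\},$$ and a base of neighborhoods of a point $\widetilde{x}\in M_\infty$ is given by the sets $$O(a_1,\dots,a_k,n,\varepsilon)=\Big\{\widetilde{y}\in\bigcup_{N=n}^\infty M_N\cup M_\infty:\ |a_i(x_n)-a_i(y_n)|<\varepsilon,\ i=1,\dots,k\Big\},$$ where $\varepsilon>0$, $a_i\in\mathcal{A}$ and $k,n\in\mathbb{N}\cup\{0\}$. Then the mapping $\widetilde{x}\mapsto(\xi^0_{\widetilde{x}},\xi^1_{\widetilde{x}},\xi^2_{\widetilde{x}},\dots)$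 defines a topological embedding (a homeomorphism onto its image) $$M(\overline{E_*(\mathcal{A})})\hookrightarrow\bigcup_{N=0}^\infty M_N\cup M_\infty .$$
   Context: $L(H)$ is the algebra of bounded operators on $H$, $1$ is its identity, and $\mathcal{A}'$ is the commutant of $\mathcal{A}$ in $L(H)$. Endomorphisms are $*$-homomorphisms into the same algebra, not necessarily unital. (Since $\delta$ is an endomorphism of $\mathcal{A}\ni 1$, $U$ is a partial isometry.) For a unital commutative $C^*$-algebra $\mathcal{B}$, $M(\mathcal{B})$ is its maximal ideal space, i.e. the space of nonzero multiplicative linear functionals with the weak-$*$ topology. $\mathcal{B}$ is identified with $C(M(\mathcal{B}))$ by the Gelfand transform, so $a(x)=x(a)$ for $a\in\mathcal{B}$, $x\in M(\mathcal{B})$. The partial mapping: $\Delta=\{\tau\in M(\mathcal{A}):\tau(UU^* )=1\}$ is closed and open, and $\alpha:\Delta\to M(\mathcal{A})$, $\alpha(\tau)=\tau\circ\delta$, is continuous; equivalently, for $f\in C(M(\mathcal{A}))$, $(\delta f)(x)=f(\alpha(x))$ if $x\in\Delta$ and $(\delta f)(x)=0$ if $x\notin\Delta$. For $n\ge 0$, $\Delta_n=\alpha^{-n}(M(\mathcal{A}))$ is the set on which $\alpha^n$ is defined (so $\Delta_0=M(\mathcal{A})$, $\Delta_1=\Delta$). The coefficient algebra: $\delta_*(x)=U^*xU$ for $x\in L(H)$, $\delta_*^0(x)=x$, and $\overline{E_*(\mathcal{A})}$ is the $C^*$-algebra generated by $\bigcup_{n=0}^\infty\delta_*^n(\mathcal{A})$.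 It is known that under the present hypotheses $\overline{E_*(\mathcal{A})}$ is commutative and that both $\delta$ and $\delta_*$ restrict to endomorphisms of it. For $\widetilde{x}\in M(\overline{E_*(\mathcal{A})})$ and $n\ge 0$, the functional $\xi^n_{\widetilde{x}}:\mathcal{A}\to\mathbb{C}$ is $\xi^n_{\widetilde{x}}(a)=\widetilde{x}(\delta_*^n(a))=\widetilde{x}(U^{*n}aU^n)$. It is multiplicative and linear, so it is either an element $x_n\in M(\mathcal{A})$ or the zero functional (written $0$). *)

theory Defs
  imports "HOL-Analysis.Analysis"
begin

text \<open>Complex Hilbert spaces. The last axiom says that the norm is the one induced by the
  inner product; positive definiteness of the inner product follows from it.\<close>

class chilbert_space = banach +
  fixes scaleC :: "complex \<Rightarrow> 'a \<Rightarrow> 'a" (infixr "*\<^sub>C" 75)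
    and cinner :: "'a \<Rightarrow> 'a \<Rightarrow> complex"
  assumes scaleC_of_real: "complex_of_real r *\<^sub>C x = r *\<^sub>R x"
    and scaleC_add_left: "(c + d) *\<^sub>C x = c *\<^sub>C x + d *\<^sub>C x"
    and scaleC_add_right: "c *\<^sub>C (x + y) = c *\<^sub>C x + c *\<^sub>C y"
    and scaleC_scaleC: "c *\<^sub>C d *\<^sub>C x = (c * d) *\<^sub>C x"
    and cinner_commute: "cinner x y = cnj (cinner y x)"
    and cinner_add_left: "cinner (x + y) z = cinner x z + cinner y z"
    and cinner_scaleC_left: "cinner (c *\<^sub>C x) y = cnj c * cinner x y"
    and cinner_same: "cinner x x = complex_of_real ((norm x)\<^sup>2)"

type_synonym 'h operator = "'h \<Rightarrow>\<^sub>L 'h"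

text \<open>The library type of bounded linear maps consists of the real-linear ones, so \<open>L(H)\<close> is
  a subset of it. The operator norm, the product (composition) and the unit are those of the
  library type.\<close>

definition bounded_operators :: "'h::chilbert_space operator set" where
  "bounded_operators = {T. \<forall>c x. blinfun_apply T (c *\<^sub>C x) = c *\<^sub>C blinfun_apply T x}"

lemma norm_scaleC: "norm (c *\<^sub>C x) = cmod c * norm (x::'h::chilbert_space)"
proof -
  have "cinner (c *\<^sub>C x) (c *\<^sub>C x) = cnj c * cnj (cnj c * cinner x x)"
    by (metis cinner_commute cinner_scaleC_left)
  also have "\<dots> = (c * cnj c) * complex_of_real ((norm x)\<^sup>2)"
    by (simp add: cinner_same)
  also have "\<dots> = complex_of_real ((cmod c * norm x)\<^sup>2)"
    by (simp only: complex_norm_square[symmetric] power_mult_distrib of_real_mult)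
  finally have "complex_of_real ((norm (c *\<^sub>C x))\<^sup>2) = complex_of_real ((cmod c * norm x)\<^sup>2)"
    by (simp only: cinner_same)
  then have "(norm (c *\<^sub>C x))\<^sup>2 = (cmod c * norm x)\<^sup>2"
    by (simp only: of_real_eq_iff)
  then show ?thesis
    by (simp add: power2_eq_iff_nonneg)
qed

lemma bounded_linear_scaleC: "bounded_linear (\<lambda>x::'h::chilbert_space. c *\<^sub>C x)"
proof (rule bounded_linear_intro[where K = "cmod c"])
  show "c *\<^sub>C (r *\<^sub>R x) = r *\<^sub>R (c *\<^sub>C x)" for r and x :: 'h
    by (simp add: scaleC_of_real[symmetric] scaleC_scaleC mult.commute)
qed (simp_all add: scaleC_add_right norm_scaleC mult.commute)

definition scale_operator :: "complex \<Rightarrow> 'h::chilbert_space operator \<Rightarrow> 'h operator" where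
  "scale_operator c T = Blinfun (\<lambda>x. c *\<^sub>C blinfun_apply T x)"

lemma scale_operator_apply:
  "blinfun_apply (scale_operator c T) x = c *\<^sub>C blinfun_apply T (x::'h::chilbert_space)"
  unfolding scale_operator_def
  by (subst bounded_linear_Blinfun_apply)
     (auto intro: bounded_linear_compose[OF bounded_linear_scaleC] blinfun.bounded_linear_right)

definition adjoint_op :: "'h::chilbert_space operator \<Rightarrow> 'h operator" where
  "adjoint_op T = (THE S. S \<in> bounded_operators \<and>
     (\<forall>x y. cinner (blinfun_apply S x) y = cinner x (blinfun_apply T y)))"

definition cstar_subalgebra :: "'h::chilbert_space operator set \<Rightarrow> bool" where
  "cstar_subalgebra B \<longleftrightarrow> B \<subseteq> bounded_operators \<and> 0 \<in> B \<and> closed B \<and>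
     (\<forall>a\<in>B. \<forall>b\<in>B. a + b \<in> B \<and> a o\<^sub>L b \<in> B) \<and>
     (\<forall>a\<in>B. adjoint_op a \<in> B \<and> (\<forall>c. scale_operator c a \<in> B))"

definition commutative_ops :: "'h::chilbert_space operator set \<Rightarrow> bool" where
  "commutative_ops B \<longleftrightarrow> (\<forall>a\<in>B. \<forall>b\<in>B. a o\<^sub>L b = b o\<^sub>L a)"

definition commutant :: "'h::chilbert_space operator set \<Rightarrow> 'h operator set" where
  "commutant B = {T \<in> bounded_operators. \<forall>b\<in>B. T o\<^sub>L b = b o\<^sub>L T}"

definition cstar_generated :: "'h::chilbert_space operator set \<Rightarrow> 'h operator set" where
  "cstar_generated S = \<Inter>{B. cstar_subalgebra B \<and> S \<subseteq> B}"

definition star_endomorphism ::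
    "'h::chilbert_space operator set \<Rightarrow> ('h operator \<Rightarrow> 'h operator) \<Rightarrow> bool" where
  "star_endomorphism B \<phi> \<longleftrightarrow> (\<forall>a\<in>B. \<phi> a \<in> B) \<and>
     (\<forall>a\<in>B. \<forall>b\<in>B. \<phi> (a + b) = \<phi> a + \<phi> b \<and> \<phi> (a o\<^sub>L b) = \<phi> a o\<^sub>L \<phi> b) \<and>
     (\<forall>a\<in>B. \<phi> (adjoint_op a) = adjoint_op (\<phi> a) \<and>
       (\<forall>c. \<phi> (scale_operator c a) = scale_operator c (\<phi> a)))"

text \<open>A functional on \<open>B\<close> is represented by its extensional extension (constantly
  \<open>undefined\<close> off \<open>B\<close>). Hence functionals on \<open>B\<close> are equal iff they agree on \<open>B\<close>, they are
  points of the product space indexed by \<open>B\<close>, and the weak-* topology is the subspace topology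
  inherited from that product.\<close>

definition max_ideal_space :: "'h::chilbert_space operator set \<Rightarrow> ('h operator \<Rightarrow> complex) set" where
  "max_ideal_space B = {\<tau> \<in> extensional B.
     (\<forall>a\<in>B. \<forall>b\<in>B. \<tau> (a + b) = \<tau> a + \<tau> b \<and> \<tau> (a o\<^sub>L b) = \<tau> a * \<tau> b) \<and>
     (\<forall>a\<in>B. \<forall>c. \<tau> (scale_operator c a) = c * \<tau> a) \<and>
     (\<exists>a\<in>B. \<tau> a \<noteq> 0)}"

definition weak_star_topology ::
    "'h::chilbert_space operator set \<Rightarrow> ('h operator \<Rightarrow> complex) topology" where
  "weak_star_topology B = subtopology (product_topology (\<lambda>_. euclidean) B) (max_ideal_space B)"

definition zero_functional :: "'h::chilbert_space operator set \<Rightarrow> 'h operator \<Rightarrow> complex" where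
  "zero_functional B = (\<lambda>a\<in>B. 0)"

definition delta :: "'h::chilbert_space operator \<Rightarrow> 'h operator \<Rightarrow> 'h operator" where
  "delta U a = U o\<^sub>L a o\<^sub>L adjoint_op U"

definition delta_star :: "'h::chilbert_space operator \<Rightarrow> 'h operator \<Rightarrow> 'h operator" where
  "delta_star U x = adjoint_op U o\<^sub>L x o\<^sub>L U"

definition coefficient_algebra ::
    "'h::chilbert_space operator set \<Rightarrow> 'h operator \<Rightarrow> 'h operator set" where
  "coefficient_algebra A U = cstar_generated (\<Union>n. (delta_star U ^^ n) ` A)"

text \<open>The partial mapping \<open>\<alpha>\<close> is the function \<open>alpha\<close>, used only on its domain
  \<open>Delta\<close>; \<open>Delta_iter n\<close> is the domain of its \<open>n\<close>-th iterate.\<close>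

definition Delta ::
    "'h::chilbert_space operator set \<Rightarrow> 'h operator \<Rightarrow> ('h operator \<Rightarrow> complex) set" where
  "Delta A U = {\<tau> \<in> max_ideal_space A. \<tau> (U o\<^sub>L adjoint_op U) = 1}"

definition alpha :: "'h::chilbert_space operator set \<Rightarrow> 'h operator \<Rightarrow>
    ('h operator \<Rightarrow> complex) \<Rightarrow> 'h operator \<Rightarrow> complex" where
  "alpha A U \<tau> = (\<lambda>a\<in>A. \<tau> (delta U a))"

primrec Delta_iter ::
    "'h::chilbert_space operator set \<Rightarrow> 'h operator \<Rightarrow> nat \<Rightarrow> ('h operator \<Rightarrow> complex) set" where
  "Delta_iter A U 0 = max_ideal_space A"
| "Delta_iter A U (Suc n) = {\<tau> \<in> Delta A U. alpha A U \<tau> \<in> Delta_iter A U n}"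

definition M_fin :: "'h::chilbert_space operator set \<Rightarrow> 'h operator \<Rightarrow> nat \<Rightarrow>
    (nat \<Rightarrow> 'h operator \<Rightarrow> complex) set" where
  "M_fin A U N = {x. (\<forall>n\<le>N. x n \<in> Delta_iter A U n) \<and>
     (\<forall>n\<in>{1..N}. alpha A U (x n) = x (n - 1)) \<and> (\<forall>n>N. x n = zero_functional A)}"

definition M_inf :: "'h::chilbert_space operator set \<Rightarrow> 'h operator \<Rightarrow>
    (nat \<Rightarrow> 'h operator \<Rightarrow> complex) set" where
  "M_inf A U = {x. (\<forall>n. x n \<in> Delta_iter A U n) \<and> (\<forall>n\<ge>1. alpha A U (x n) = x (n - 1))}"

definition seq_space :: "'h::chilbert_space operator set \<Rightarrow> 'h operator \<Rightarrow>
    (nat \<Rightarrow> 'h operator \<Rightarrow> complex) set" where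
  "seq_space A U = (\<Union>N. M_fin A U N) \<union> M_inf A U"

text \<open>Here \<open>a\<^sub>1, \<dots>, a\<^sub>k\<close> is given by the finite set \<open>F = {a\<^sub>1, \<dots>, a\<^sub>k}\<close>, empty for \<open>k = 0\<close>.\<close>

definition nbhd_fin :: "'h::chilbert_space operator set \<Rightarrow> 'h operator \<Rightarrow>
    nat \<Rightarrow> (nat \<Rightarrow> 'h operator \<Rightarrow> complex) \<Rightarrow> 'h operator set \<Rightarrow> real \<Rightarrow>
    (nat \<Rightarrow> 'h operator \<Rightarrow> complex) set" where
  "nbhd_fin A U N x F \<epsilon> = {y \<in> M_fin A U N. \<forall>a\<in>F. cmod (x N a - y N a) < \<epsilon>}"

definition nbhd_inf :: "'h::chilbert_space operator set \<Rightarrow> 'h operator \<Rightarrow>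
    (nat \<Rightarrow> 'h operator \<Rightarrow> complex) \<Rightarrow> 'h operator set \<Rightarrow> nat \<Rightarrow> real \<Rightarrow>
    (nat \<Rightarrow> 'h operator \<Rightarrow> complex) set" where
  "nbhd_inf A U x F n \<epsilon> =
     {y \<in> (\<Union>N\<in>{n..}. M_fin A U N) \<union> M_inf A U. \<forall>a\<in>F. cmod (x n a - y n a) < \<epsilon>}"

definition nbhd_base :: "'h::chilbert_space operator set \<Rightarrow> 'h operator \<Rightarrow>
    (nat \<Rightarrow> 'h operator \<Rightarrow> complex) \<Rightarrow> (nat \<Rightarrow> 'h operator \<Rightarrow> complex) set set" where
  "nbhd_base A U x =
     {nbhd_fin A U N x F \<epsilon> | N F \<epsilon>. x \<in> M_fin A U N \<and> finite F \<and> F \<subseteq> A \<and> 0 < \<epsilon>} \<union>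
     {nbhd_inf A U x F n \<epsilon> | F n \<epsilon>. x \<in> M_inf A U \<and> finite F \<and> F \<subseteq> A \<and> 0 < \<epsilon>}"

text \<open>That the predicate below really is a topology, and that the sets in \<open>nbhd_base A U x\<close>
  are then open neighbourhoods of \<open>x\<close>, is shown at the end of this theory for every \<open>A\<close> that
  is invariant under \<open>\<delta>\<close>.\<close>

definition seq_topology :: "'h::chilbert_space operator set \<Rightarrow> 'h operator \<Rightarrow>
    (nat \<Rightarrow> 'h operator \<Rightarrow> complex) topology" where
  "seq_topology A U = topology (\<lambda>W. W \<subseteq> seq_space A U \<and>
     (\<forall>x\<in>W. \<exists>V\<in>nbhd_base A U x. V \<subseteq> W))"

definition xi :: "'h::chilbert_space operator set \<Rightarrow> 'h operator \<Rightarrow>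
    ('h operator \<Rightarrow> complex) \<Rightarrow> nat \<Rightarrow> 'h operator \<Rightarrow> complex" where
  "xi A U x n = (\<lambda>a\<in>A. x ((delta_star U ^^ n) a))"

lemma Delta_iter_ne_zero: "\<tau> \<in> Delta_iter A U n \<Longrightarrow> \<tau> \<noteq> zero_functional A"
  by (cases n) (auto simp: Delta_def max_ideal_space_def zero_functional_def)

lemma M_fin_disjoint:
  assumes "N \<noteq> K"
  shows "M_fin A U N \<inter> M_fin A U K = {}"
proof -
  have "False" if "x \<in> M_fin A U i" "x \<in> M_fin A U j" "i < j" for x i j
  proof -
    have "x j \<in> Delta_iter A U j" "x j = zero_functional A"
      using that unfolding M_fin_def by blast+
    then show ?thesis
      using Delta_iter_ne_zero by blast
  qed
  then show ?thesis
    using assms by (metis disjoint_iff linorder_neqE_nat)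
qed

lemma M_fin_M_inf_disjoint: "M_fin A U N \<inter> M_inf A U = {}"
proof -
  have "False" if "x \<in> M_fin A U N" "x \<in> M_inf A U" for x
  proof -
    have "x (Suc N) \<in> Delta_iter A U (Suc N)" "x (Suc N) = zero_functional A"
      using that unfolding M_fin_def M_inf_def by blast+
    then show ?thesis
      using Delta_iter_ne_zero by blast
  qed
  then show ?thesis by blast
qed

lemma funpow_delta_mem:
  assumes "\<forall>a\<in>A. delta U a \<in> A" "a \<in> A"
  shows "(delta U ^^ k) a \<in> A"
  using assms by (induction k) auto

lemma coordinate_shift:
  assumes "\<forall>a\<in>A. delta U a \<in> A" and "a \<in> A"
    and "\<And>j. n < j \<Longrightarrow> j \<le> n + k \<Longrightarrow> alpha A U (x j) = x (j - 1)"
  shows "x n a = x (n + k) ((delta U ^^ k) a)"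
  using assms(3)
proof (induction k)
  case (Suc k)
  have "x (n + k) = alpha A U (x (n + Suc k))"
    using Suc.prems[of "n + Suc k"] by simp
  then show ?case
    using Suc funpow_delta_mem[OF assms(1,2), of k] by (simp add: alpha_def)
qed simp

lemma coordinate_shift_seq:
  assumes "\<forall>a\<in>A. delta U a \<in> A" and "a \<in> A" and "n \<le> m"
    and "x \<in> (\<Union>N\<in>{m..}. M_fin A U N) \<union> M_inf A U"
  shows "x n a = x m ((delta U ^^ (m - n)) a)"
  using coordinate_shift[OF assms(1,2), of n "m - n" x] assms(3,4)
  by (auto simp: M_fin_def M_inf_def)

lemma nbhd_base_self: "V \<in> nbhd_base A U x \<Longrightarrow> x \<in> V"
  by (auto simp: nbhd_base_def nbhd_fin_def nbhd_inf_def)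

lemma nbhd_base_subset: "V \<in> nbhd_base A U x \<Longrightarrow> V \<subseteq> seq_space A U"
  by (auto simp: nbhd_base_def nbhd_fin_def nbhd_inf_def seq_space_def)

lemma nbhd_base_fin:
  "x \<in> M_fin A U N \<Longrightarrow> V \<in> nbhd_base A U x \<longleftrightarrow>
     (\<exists>F \<epsilon>. V = nbhd_fin A U N x F \<epsilon> \<and> finite F \<and> F \<subseteq> A \<and> 0 < \<epsilon>)"
proof -
  assume x: "x \<in> M_fin A U N"
  have "x \<notin> M_inf A U"
    using x M_fin_M_inf_disjoint[of A U N] by blast
  moreover have "x \<in> M_fin A U K \<longleftrightarrow> K = N" for K
    using x M_fin_disjoint[of N K A U] by (cases "K = N") auto
  ultimately show ?thesis
    by (simp add: nbhd_base_def)
qed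

lemma nbhd_base_inf:
  "x \<in> M_inf A U \<Longrightarrow> V \<in> nbhd_base A U x \<longleftrightarrow>
     (\<exists>F n \<epsilon>. V = nbhd_inf A U x F n \<epsilon> \<and> finite F \<and> F \<subseteq> A \<and> 0 < \<epsilon>)"
proof -
  assume x: "x \<in> M_inf A U"
  then have "x \<notin> M_fin A U K" for K
    using M_fin_M_inf_disjoint[of A U K] by blast
  with x show ?thesis
    by (simp add: nbhd_base_def)
qed

lemma nbhd_inf_shift:
  assumes "\<forall>a\<in>A. delta U a \<in> A" and "F \<subseteq> A" and "n \<le> m" and "x \<in> M_inf A U"
  shows "nbhd_inf A U x ((delta U ^^ (m - n)) ` F) m \<epsilon> \<subseteq> nbhd_inf A U x F n \<epsilon>"
proof
  fix y assume y: "y \<in> nbhd_inf A U x ((delta U ^^ (m - n)) ` F) m \<epsilon>"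
  then have mem: "y \<in> (\<Union>N\<in>{m..}. M_fin A U N) \<union> M_inf A U"
    by (auto simp: nbhd_inf_def)
  have "cmod (x n a - y n a) < \<epsilon>" if "a \<in> F" for a
  proof -
    have "a \<in> A" using that assms(2) by auto
    then show ?thesis
      using coordinate_shift_seq[OF assms(1) _ assms(3) mem]
        coordinate_shift_seq[OF assms(1) _ assms(3), of a x] assms(4) y that
      by (auto simp: nbhd_inf_def)
  qed
  then show "y \<in> nbhd_inf A U x F n \<epsilon>"
    using mem assms(3) by (fastforce simp: nbhd_inf_def)
qed

lemma nbhd_base_Int:
  assumes inv: "\<forall>a\<in>A. delta U a \<in> A"
    and V: "V \<in> nbhd_base A U x" and W: "W \<in> nbhd_base A U x"
  shows "\<exists>Z\<in>nbhd_base A U x. Z \<subseteq> V \<inter> W"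
proof -
  consider N where "x \<in> M_fin A U N" | "x \<in> M_inf A U"
    using V by (auto simp: nbhd_base_def)
  then show ?thesis
  proof cases
    case 1
    obtain F e G d where
      "V = nbhd_fin A U N x F e" "finite F" "F \<subseteq> A" "0 < e"
      "W = nbhd_fin A U N x G d" "finite G" "G \<subseteq> A" "0 < d"
      using V W 1 by (auto simp: nbhd_base_fin)
    moreover have "finite (F \<union> G)" "F \<union> G \<subseteq> A" "0 < min e d"
      using calculation by auto
    then have "nbhd_fin A U N x (F \<union> G) (min e d) \<in> nbhd_base A U x"
      using nbhd_base_fin[OF 1] by blast
    moreover have "nbhd_fin A U N x (F \<union> G) (min e d) \<subseteq> V \<inter> W"
      unfolding calculation(1,5) by (auto simp: nbhd_fin_def)
    ultimately show ?thesis by blast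
  next
    case 2
    obtain F n e G m d where F:
      "V = nbhd_inf A U x F n e" "finite F" "F \<subseteq> A" "0 < e" and G:
      "W = nbhd_inf A U x G m d" "finite G" "G \<subseteq> A" "0 < d"
      using V W 2 by (auto simp: nbhd_base_inf)
    define k where "k = max n m"
    define F' where "F' = (delta U ^^ (k - n)) ` F"
    define G' where "G' = (delta U ^^ (k - m)) ` G"
    let ?Z = "nbhd_inf A U x (F' \<union> G') k (min e d)"
    have "F' \<union> G' \<subseteq> A" "finite (F' \<union> G')" "0 < min e d"
      using F G funpow_delta_mem[OF inv] by (auto simp: F'_def G'_def)
    then have "?Z \<in> nbhd_base A U x"
      using nbhd_base_inf[OF 2] by blast
    moreover have "?Z \<subseteq> nbhd_inf A U x F' k e" "?Z \<subseteq> nbhd_inf A U x G' k d"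
      by (auto simp: nbhd_inf_def)
    then have "?Z \<subseteq> V \<inter> W"
      using nbhd_inf_shift[OF inv F(3) _ 2, of n k e] nbhd_inf_shift[OF inv G(3) _ 2, of m k d]
      unfolding F(1) G(1) F'_def G'_def k_def by (meson Int_greatest max.cobounded1 max.cobounded2 order_trans)
    ultimately show ?thesis by blast
  qed
qed

lemma istopology_seq_topology:
  assumes "\<forall>a\<in>A. delta U a \<in> A"
  shows "istopology (\<lambda>W. W \<subseteq> seq_space A U \<and> (\<forall>x\<in>W. \<exists>V\<in>nbhd_base A U x. V \<subseteq> W))"
  unfolding istopology_def
proof (intro conjI allI impI ballI)
  fix S T x
  assume S: "S \<subseteq> seq_space A U \<and> (\<forall>x\<in>S. \<exists>V\<in>nbhd_base A U x. V \<subseteq> S)"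
    and T: "T \<subseteq> seq_space A U \<and> (\<forall>x\<in>T. \<exists>V\<in>nbhd_base A U x. V \<subseteq> T)"
    and x: "x \<in> S \<inter> T"
  from S x obtain V where "V \<in> nbhd_base A U x" "V \<subseteq> S"
    by blast
  moreover from T x obtain W where "W \<in> nbhd_base A U x" "W \<subseteq> T"
    by blast
  ultimately show "\<exists>V\<in>nbhd_base A U x. V \<subseteq> S \<inter> T"
    using nbhd_base_Int[OF assms, of V x W] by blast
next
  fix S T
  assume "S \<subseteq> seq_space A U \<and> (\<forall>x\<in>S. \<exists>V\<in>nbhd_base A U x. V \<subseteq> S)"
  then show "S \<inter> T \<subseteq> seq_space A U" by blast
next
  fix \<K> assume *: "\<forall>K\<in>\<K>. K \<subseteq> seq_space A U \<and> (\<forall>x\<in>K. \<exists>V\<in>nbhd_base A U x. V \<subseteq> K)"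
  then show "\<Union>\<K> \<subseteq> seq_space A U" by blast
  fix x assume "x \<in> \<Union>\<K>"
  then obtain K where "K \<in> \<K>" "x \<in> K" by blast
  moreover from this * obtain V where "V \<in> nbhd_base A U x" "V \<subseteq> K" by blast
  ultimately show "\<exists>V\<in>nbhd_base A U x. V \<subseteq> \<Union>\<K>" by blast
qed

lemma openin_seq_topology:
  assumes "\<forall>a\<in>A. delta U a \<in> A"
  shows "openin (seq_topology A U) W \<longleftrightarrow>
     W \<subseteq> seq_space A U \<and> (\<forall>x\<in>W. \<exists>V\<in>nbhd_base A U x. V \<subseteq> W)"
  unfolding seq_topology_def topology_inverse'[OF istopology_seq_topology[OF assms]] by (rule refl)

lemma finite_ball_margin:
  fixes f g :: "'b \<Rightarrow> complex"
  assumes "finite F" "0 < \<epsilon>" "\<forall>a\<in>F. cmod (f a - g a) < \<epsilon>"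
  shows "\<exists>d>0. \<forall>h. (\<forall>a\<in>F. cmod (g a - h a) < d) \<longrightarrow> (\<forall>a\<in>F. cmod (f a - h a) < \<epsilon>)"
proof -
  define d where "d = Min (insert \<epsilon> ((\<lambda>a. \<epsilon> - cmod (f a - g a)) ` F))"
  have "0 < d" using assms by (auto simp: d_def)
  moreover have "cmod (f a - h a) < \<epsilon>" if "a \<in> F" "cmod (g a - h a) < d" for a h
  proof -
    have "d \<le> \<epsilon> - cmod (f a - g a)" using assms(1) that(1) by (auto simp: d_def)
    then show ?thesis using that(2) norm_triangle_ineq[of "f a - g a" "g a - h a"] by simp
  qed
  ultimately show ?thesis by blast
qed

lemma openin_nbhd_base:
  assumes inv: "\<forall>a\<in>A. delta U a \<in> A" and V: "V \<in> nbhd_base A U x"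
  shows "openin (seq_topology A U) V"
proof -
  have "\<exists>W\<in>nbhd_base A U y. W \<subseteq> V" if y: "y \<in> V" for y
  proof -
    consider (fin) N F e where "V = nbhd_fin A U N x F e" "finite F" "F \<subseteq> A" "0 < e"
      | (inf) F n e where "V = nbhd_inf A U x F n e" "finite F" "F \<subseteq> A" "0 < e"
      using V unfolding nbhd_base_def by auto
    then show ?thesis
    proof cases
      case fin
      then have yN: "y \<in> M_fin A U N" "\<forall>a\<in>F. cmod (x N a - y N a) < e"
        using y by (auto simp: nbhd_fin_def)
      obtain d where d: "d > 0"
        "\<And>h. \<forall>a\<in>F. cmod (y N a - h a) < d \<Longrightarrow> \<forall>a\<in>F. cmod (x N a - h a) < e"
        using finite_ball_margin[OF fin(2,4) yN(2)] by metis
      have "nbhd_fin A U N y F d \<in> nbhd_base A U y"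
        using fin d(1) nbhd_base_fin[OF yN(1)] by blast
      moreover have "nbhd_fin A U N y F d \<subseteq> V"
        using d(2)[of "z N" for z] unfolding fin(1) nbhd_fin_def by blast
      ultimately show ?thesis by blast
    next
      case inf
      then have yn: "\<forall>a\<in>F. cmod (x n a - y n a) < e"
        using y by (auto simp: nbhd_inf_def)
      obtain d where d: "d > 0"
        "\<And>h. \<forall>a\<in>F. cmod (y n a - h a) < d \<Longrightarrow> \<forall>a\<in>F. cmod (x n a - h a) < e"
        using finite_ball_margin[OF inf(2,4) yn] by metis
      consider (a) "y \<in> M_inf A U" | (b) N where "n \<le> N" "y \<in> M_fin A U N"
        using y inf(1) by (auto simp: nbhd_inf_def)
      then show ?thesis
      proof cases
        case a
        have "nbhd_inf A U y F n d \<in> nbhd_base A U y"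
          using inf d(1) nbhd_base_inf[OF a] by blast
        moreover have "nbhd_inf A U y F n d \<subseteq> V"
          using d(2)[of "z n" for z] unfolding inf(1) nbhd_inf_def by blast
        ultimately show ?thesis by blast
      next
        case b
        let ?W = "nbhd_fin A U N y ((delta U ^^ (N - n)) ` F) d"
        have "(delta U ^^ (N - n)) ` F \<subseteq> A"
          using inf(3) funpow_delta_mem[OF inv] by auto
        then have "?W \<in> nbhd_base A U y"
          using inf(2) d(1) nbhd_base_fin[OF b(2)] by blast
        moreover have "?W \<subseteq> V"
        proof
          fix z assume z: "z \<in> ?W"
          then have zN: "z \<in> M_fin A U N" by (simp add: nbhd_fin_def)
          then have UN_z: "z \<in> (\<Union>K\<in>{N..}. M_fin A U K) \<union> M_inf A U" by blast
          have UN_y: "y \<in> (\<Union>K\<in>{N..}. M_fin A U K) \<union> M_inf A U" using b(2) by blast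
          have "cmod (y n a - z n a) < d" if "a \<in> F" for a
          proof -
            have "a \<in> A" using that inf(3) by auto
            then show ?thesis
              using coordinate_shift_seq[OF inv _ b(1), of a z]
                coordinate_shift_seq[OF inv _ b(1), of a y] UN_z UN_y z that
              by (simp add: nbhd_fin_def)
          qed
          then show "z \<in> V"
            using d(2)[of "z n"] zN b(1) unfolding inf(1) nbhd_inf_def by auto
        qed
        ultimately show ?thesis by blast
      qed
    qed
  qed
  then show ?thesis
    using nbhd_base_subset[OF V] by (auto simp: openin_seq_topology[OF inv])
qed

lemma topspace_seq_topology:
  assumes "\<forall>a\<in>A. delta U a \<in> A"
  shows "topspace (seq_topology A U) = seq_space A U"
proof -
  have "\<exists>V. V \<in> nbhd_base A U x" if x: "x \<in> seq_space A U" for x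
  proof -
    consider N where "x \<in> M_fin A U N" | "x \<in> M_inf A U"
      using x by (auto simp: seq_space_def)
    then show ?thesis
    proof cases
      case 1
      have "nbhd_fin A U N x {} 1 \<in> nbhd_base A U x"
        using nbhd_base_fin[OF 1] finite.emptyI empty_subsetI zero_less_one by metis
      then show ?thesis ..
    next
      case 2
      have "nbhd_inf A U x {} 0 1 \<in> nbhd_base A U x"
        using nbhd_base_inf[OF 2] finite.emptyI empty_subsetI zero_less_one by metis
      then show ?thesis ..
    qed
  qed
  then have "\<exists>V\<in>nbhd_base A U x. V \<subseteq> seq_space A U" if "x \<in> seq_space A U" for x
    using that nbhd_base_subset by (meson bexI)
  then have "openin (seq_topology A U) (seq_space A U)"
    by (simp add: openin_seq_topology[OF assms])
  moreover have "topspace (seq_topology A U) \<subseteq> seq_space A U"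
    using iffD1[OF openin_seq_topology[OF assms] openin_topspace] by (rule conjunct1)
  ultimately show ?thesis
    by (simp add: openin_subset subset_antisym)
qed

end

theory Submission
  imports Defs
begin

text \<open>Put \<open>e\<^sub>n = \<delta>\<^sub>*\<^sup>n 1 = U\<^sup>*\<^sup>n U\<^sup>n\<close>. Every power of \<open>U\<close> is a partial isometry whose range
  projection \<open>\<delta>\<^sup>n 1\<close> lies in \<open>A\<close>, and this yields the two identities behind the theorem:
  \<open>\<delta>\<^sub>*\<^sup>n (T a) = \<delta>\<^sub>*\<^sup>n T \<delta>\<^sub>*\<^sup>n a\<close> for \<open>a \<in> A\<close> and any operator \<open>T\<close>, and
  \<open>\<delta>\<^sub>*\<^sup>n\<^sup>+\<^sup>1 (\<delta> a) = e\<^sub>n\<^sub>+\<^sub>1 \<delta>\<^sub>*\<^sup>n a\<close> (\<open>iter_compose\<close>, \<open>iter_Suc_delta\<close>).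

  Let \<open>x\<close> be a character of the coefficient algebra. By the first identity the numbers \<open>x e\<^sub>n\<close> are
  \<open>0\<close> or \<open>1\<close> and decrease in \<open>n\<close>, and the coordinate \<open>a \<mapsto> x (\<delta>\<^sub>*\<^sup>n a)\<close> is a character of \<open>A\<close> or
  zero according to this value. By the second, \<open>\<alpha>\<close> takes each nonzero coordinate to its
  predecessor. So the position of the last nonzero coordinate decides in which \<open>M\<^sub>N\<close>, or in
  \<open>M\<^sub>\<infinity>\<close>, the coordinate sequence lies.

  Continuity: membership in a basic neighbourhood is expressed by finitely many inequalities
  between values of \<open>x\<close> and by conditions \<open>x e\<^sub>n = 1\<close> or \<open>x e\<^sub>n = 0\<close>, which are open because no
  other values occur (\<open>openin_preimage_nbhd_base\<close>).

  Injectivity and continuity of the inverse both come from an induction over the coefficient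
  algebra (\<open>cstar_generated_induct\<close>). The elements on which two given characters agree, and
  likewise the elements \<open>b\<close> for which \<open>x b\<close> depends continuously on the coordinate sequence of
  \<open>x\<close>, are closed under sums, products, multiples and, since characters are contractive, norm
  limits. They include the generators \<open>\<delta>\<^sub>*\<^sup>n a\<close>, whose values are coordinates.\<close>

section \<open>Adjoints in a complex Hilbert space\<close>

lemma cinner_add_right: "cinner x (y + z) = cinner x y + cinner x (z::'h::chilbert_space)"
  by (metis cinner_add_left cinner_commute complex_cnj_add)

lemma cinner_scaleC_right: "cinner x (c *\<^sub>C y) = c * cinner x (y::'h::chilbert_space)"
  by (metis cinner_commute cinner_scaleC_left complex_cnj_cnj complex_cnj_mult)

lemma cinner_scaleR_right: "cinner x (r *\<^sub>R y) = complex_of_real r * cinner x (y::'h::chilbert_space)"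
  by (metis cinner_scaleC_right scaleC_of_real)

lemma cinner_minus_right: "cinner x (- y) = - cinner x (y::'h::chilbert_space)"
  using cinner_scaleR_right[of x "-1" y] by simp

lemma cinner_diff_left: "cinner (x - y) z = cinner x z - cinner y (z::'h::chilbert_space)"
  by (metis add_diff_cancel cinner_add_left diff_add_cancel)

lemma cinner_nondegenerate:
  fixes u v :: "'h::chilbert_space"
  assumes "\<And>y. cinner u y = cinner v y"
  shows "u = v"
proof -
  have "cinner (u - v) (u - v) = 0"
    by (simp add: cinner_diff_left assms)
  then show ?thesis
    by (simp add: cinner_same)
qed

lemma norm_add_square:
  "(norm (x + y))\<^sup>2 = (norm x)\<^sup>2 + (norm y)\<^sup>2 + 2 * Re (cinner x (y::'h::chilbert_space))"
proof -
  have "Re (cinner (x + y) (x + y)) = Re (cinner x x) + Re (cinner y y) + 2 * Re (cinner x y)"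
    using cinner_commute[of y x] by (simp add: cinner_add_left cinner_add_right)
  then show ?thesis
    by (simp add: cinner_same flip: of_real_power)
qed

lemma parallelogram:
  "(norm (x + y))\<^sup>2 + (norm (x - y))\<^sup>2 = 2 * (norm x)\<^sup>2 + 2 * (norm (y::'h::chilbert_space))\<^sup>2"
  using norm_add_square[of x y] norm_add_square[of x "- y"] by (simp add: cinner_minus_right)

text \<open>Expanding the square of the triangle inequality gives the Cauchy--Schwarz bound.\<close>

lemma Re_cinner_le: "Re (cinner x y) \<le> norm x * norm (y::'h::chilbert_space)"
proof -
  have "(norm (x + y))\<^sup>2 \<le> (norm x + norm y)\<^sup>2"
    by (intro power_mono norm_triangle_ineq) simp
  then show ?thesis
    by (simp add: norm_add_square power2_sum)
qed

lemma abs_Re_cinner_le: "\<bar>Re (cinner x y)\<bar> \<le> norm x * norm (y::'h::chilbert_space)"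
  using Re_cinner_le[of x y] Re_cinner_le[of x "- y"] by (simp add: cinner_minus_right abs_le_iff)

lemma bounded_linear_Re_cinner: "bounded_linear (\<lambda>y. Re (cinner x (y::'h::chilbert_space)))"
  by (rule bounded_linear_intro[where K = "norm x"])
     (use abs_Re_cinner_le[of x] in \<open>auto simp: cinner_add_right cinner_scaleR_right mult.commute\<close>)

text \<open>The Riesz vector of \<open>g\<close> is the minimiser of the energy \<open>y \<mapsto> \<parallel>y\<parallel>\<^sup>2 - 2 g y\<close>: by the
  parallelogram law a minimising sequence is Cauchy, and at a minimum the first variation
  vanishes.\<close>

lemma riesz_representation:
  fixes g :: "'h::chilbert_space \<Rightarrow> real"
  assumes "bounded_linear g"
  obtains y where "\<And>z. Re (cinner y z) = g z"
proof -
  interpret g: bounded_linear g by fact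
  define J where "J y = (norm y)\<^sup>2 - 2 * g y" for y
  obtain K where K: "\<And>y. norm (g y) \<le> norm y * K" using g.bounded by blast
  have lower: "- K\<^sup>2 \<le> J y" for y
  proof -
    have "g y \<le> norm y * K" using K[of y] by simp
    moreover have "0 \<le> (norm y - K)\<^sup>2" by simp
    ultimately show ?thesis unfolding J_def by (simp add: power2_diff)
  qed
  define m where "m = Inf (range J)"
  have bdd: "bdd_below (range J)" using lower by (auto intro: bdd_belowI[of _ "- K\<^sup>2"])
  have m_le: "m \<le> J y" for y unfolding m_def using bdd by (simp add: cInf_lower)
  have "\<exists>y. J y < m + inverse (real (Suc n))" for n
    using cInf_lessD[of "range J" "m + inverse (real (Suc n))"] unfolding m_def by auto
  then obtain s where s: "\<And>n. J (s n) < m + inverse (real (Suc n))" by metis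
  have gap: "(norm (y - z))\<^sup>2 \<le> 2 * (J y - m) + 2 * (J z - m)" for y z
  proof -
    have "4 * J ((1/2) *\<^sub>R (y + z)) = (norm (y + z))\<^sup>2 - 4 * (g y + g z)"
      unfolding J_def g.scaleR g.add norm_scaleR power_mult_distrib by (simp add: power2_eq_square add_divide_distrib)
    moreover have "4 * m \<le> 4 * J ((1/2) *\<^sub>R (y + z))" using m_le by simp
    ultimately show ?thesis
      using parallelogram[of y z] unfolding J_def by simp
  qed
  have "Cauchy s"
  proof (rule metric_CauchyI)
    fix e :: real assume "0 < e"
    then obtain N where N: "inverse (real (Suc N)) < e\<^sup>2 / 4"
      using reals_Archimedean[of "e\<^sup>2 / 4"] by auto
    have small: "J (s k) - m < e\<^sup>2 / 4" if "N \<le> k" for k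
    proof -
      have "inverse (real (Suc k)) \<le> inverse (real (Suc N))"
        using that by (intro le_imp_inverse_le) auto
      then have "J (s k) < m + e\<^sup>2 / 4" using s[of k] N by (meson add_strict_left_mono less_trans le_less_trans)
      then show ?thesis by (simp add: algebra_simps)
    qed
    have "dist (s i) (s j) < e" if "N \<le> i" "N \<le> j" for i j
    proof -
      have "(norm (s i - s j))\<^sup>2 \<le> 2 * (J (s i) - m) + 2 * (J (s j) - m)" by (rule gap)
      also have "\<dots> < 2 * (e\<^sup>2 / 4) + 2 * (e\<^sup>2 / 4)"
        by (intro add_strict_mono mult_strict_left_mono small that) auto
      also have "\<dots> = e\<^sup>2" by simp
      finally have "(norm (s i - s j))\<^sup>2 < e\<^sup>2" .
      then show ?thesis
        using \<open>0 < e\<close> by (simp add: dist_norm power2_less_imp_less)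
    qed
    then show "\<exists>N. \<forall>i\<ge>N. \<forall>j\<ge>N. dist (s i) (s j) < e" by blast
  qed
  then obtain y where y: "s \<longlonglongrightarrow> y"
    using Cauchy_convergent_iff convergent_def by blast
  have "(\<lambda>n. J (s n)) \<longlonglongrightarrow> J y"
    unfolding J_def by (intro tendsto_intros y g.tendsto)
  moreover have "(\<lambda>n. m + inverse (real (Suc n))) \<longlonglongrightarrow> m + 0"
    by (intro tendsto_intros LIMSEQ_inverse_real_of_nat)
  ultimately have "J y \<le> m + 0"
    by (rule LIMSEQ_le) (use s in \<open>auto intro: less_imp_le\<close>)
  then have min: "J y \<le> J w" for w using m_le[of w] by linarith
  have "Re (cinner y z) = g z" for z
  proof (rule ccontr)
    define b where "b = Re (cinner y z) - g z"
    assume "Re (cinner y z) \<noteq> g z"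
    then have b: "b \<noteq> 0" by (simp add: b_def)
    have quad: "0 \<le> t\<^sup>2 * (norm z)\<^sup>2 + 2 * t * b" for t
      using min[of "y + t *\<^sub>R z"] unfolding J_def b_def
      by (simp add: norm_add_square cinner_scaleR_right g.add g.scaleR power_mult_distrib algebra_simps)
    \<comment> \<open>The quadratic is negative at \<open>t = - b / (\<parallel>z\<parallel>\<^sup>2 + 1)\<close>, where it equals
      \<open>- t\<^sup>2 (\<parallel>z\<parallel>\<^sup>2 + 2)\<close>.\<close>
    define t where "t = - b / ((norm z)\<^sup>2 + 1)"
    have p: "(norm z)\<^sup>2 + 1 > 0" by (simp add: add_nonneg_pos)
    have bt: "b = - t * ((norm z)\<^sup>2 + 1)" using p by (simp add: t_def)
    then have "t \<noteq> 0" using b by auto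
    have "t\<^sup>2 * (norm z)\<^sup>2 + 2 * t * b = - (t\<^sup>2 * ((norm z)\<^sup>2 + 2))"
      unfolding bt by (simp add: power2_eq_square algebra_simps)
    moreover have "t\<^sup>2 * ((norm z)\<^sup>2 + 2) > 0"
      using \<open>t \<noteq> 0\<close> by (simp add: add_nonneg_pos)
    ultimately show False using quad[of t] by linarith
  qed
  then show thesis by (rule that)
qed

lemma norm_le_of_adjoint_pair:
  fixes T :: "'h::chilbert_space operator"
  assumes adj: "\<And>x y. cinner (s x) y = cinner x (blinfun_apply T y)"
  shows "norm (s x) \<le> norm T * norm x"
proof (cases "s x = 0")
  case False
  have "(norm (s x))\<^sup>2 = Re (cinner x (T (s x)))"
    using cinner_same[of "s x"] by (simp add: adj flip: of_real_power)
  also have "\<dots> \<le> norm x * norm (T (s x))" by (rule Re_cinner_le)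
  also have "\<dots> \<le> norm x * (norm T * norm (s x))"
    by (intro mult_left_mono norm_blinfun) simp
  finally show ?thesis using False by (simp add: power2_eq_square mult.commute)
qed simp

lemma adjoint_exists:
  fixes T :: "'h::chilbert_space operator"
  assumes T: "T \<in> bounded_operators"
  shows "\<exists>S\<in>bounded_operators. \<forall>x y. cinner (blinfun_apply S x) y = cinner x (blinfun_apply T y)"
proof -
  have "\<exists>u. \<forall>z. Re (cinner u z) = Re (cinner x (T z))" for x
    using riesz_representation[OF bounded_linear_compose[OF bounded_linear_Re_cinner[of x]
      blinfun.bounded_linear_right[of T]]] by metis
  then obtain s where s: "\<And>x z. Re (cinner (s x) z) = Re (cinner x (T z))" by metis
  have adj: "cinner (s x) y = cinner x (T y)" for x y
  proof (rule complex_eqI)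
    show "Re (cinner (s x) y) = Re (cinner x (T y))" by (rule s)
    have "T (\<i> *\<^sub>C y) = \<i> *\<^sub>C T y" using T by (simp add: bounded_operators_def)
    then show "Im (cinner (s x) y) = Im (cinner x (T y))"
      using s[of x "\<i> *\<^sub>C y"] by (simp add: cinner_scaleC_right)
  qed
  have add: "s (x + y) = s x + s y" for x y
    by (rule cinner_nondegenerate) (simp add: adj cinner_add_left)
  have scaleC: "s (c *\<^sub>C x) = c *\<^sub>C s x" for c x
    by (rule cinner_nondegenerate) (simp add: adj cinner_scaleC_left)
  have bound: "norm (s x) \<le> norm x * norm T" for x
    using norm_le_of_adjoint_pair[of s T x] adj by (simp add: mult.commute)
  have "bounded_linear s"
    by (rule bounded_linear_intro[where K = "norm T"])
       (use add scaleC bound in \<open>auto simp flip: scaleC_of_real\<close>)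
  then have "blinfun_apply (Blinfun s) = s" by (rule bounded_linear_Blinfun_apply)
  then show ?thesis
    using scaleC adj by (intro bexI[of _ "Blinfun s"]) (auto simp: bounded_operators_def)
qed

lemma adjoint_op_eqI:
  fixes T :: "'h::chilbert_space operator"
  assumes "S \<in> bounded_operators" "\<And>x y. cinner (blinfun_apply S x) y = cinner x (blinfun_apply T y)"
  shows "adjoint_op T = S"
  unfolding adjoint_op_def
proof (rule the_equality)
  fix R assume "R \<in> bounded_operators \<and> (\<forall>x y. cinner (blinfun_apply R x) y = cinner x (T y))"
  then show "R = S" using assms(2) by (intro blinfun_eqI cinner_nondegenerate) simp
qed (use assms in blast)

context
  fixes T :: "'h::chilbert_space operator"
  assumes T: "T \<in> bounded_operators"
begin

lemma adjoint_op_mem: "adjoint_op T \<in> bounded_operators"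
  and cinner_adjoint_left: "cinner (blinfun_apply (adjoint_op T) x) y = cinner x (blinfun_apply T y)"
  using adjoint_exists[OF T] adjoint_op_eqI by metis+

lemma cinner_adjoint_right: "cinner x (blinfun_apply (adjoint_op T) y) = cinner (blinfun_apply T x) y"
  by (metis cinner_adjoint_left cinner_commute)

lemma adjoint_adjoint: "adjoint_op (adjoint_op T) = T"
  by (rule adjoint_op_eqI[OF T]) (simp add: cinner_adjoint_right)

lemma norm_adjoint_le: "norm (adjoint_op T) \<le> norm T"
  using norm_le_of_adjoint_pair[of "blinfun_apply (adjoint_op T)" T]
  by (intro norm_blinfun_bound) (auto simp: cinner_adjoint_left)

end

lemma bounded_operators_compose:
  "S \<in> bounded_operators \<Longrightarrow> T \<in> bounded_operators \<Longrightarrow> S o\<^sub>L T \<in> bounded_operators"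
  by (simp add: bounded_operators_def)

lemma bounded_operators_add:
  "S \<in> bounded_operators \<Longrightarrow> T \<in> bounded_operators \<Longrightarrow> S + T \<in> bounded_operators"
  by (simp add: bounded_operators_def blinfun.add_left scaleC_add_right)

lemma bounded_operators_scale: "T \<in> bounded_operators \<Longrightarrow> scale_operator c T \<in> bounded_operators"
  by (simp add: bounded_operators_def scale_operator_apply scaleC_scaleC mult.commute)

lemma bounded_operators_zero: "(0::'h::chilbert_space operator) \<in> bounded_operators"
proof -
  have "c *\<^sub>C (0::'h) = 0" for c using norm_scaleC[of c "0::'h"] by simp
  then show ?thesis by (simp add: bounded_operators_def)
qed

lemma bounded_operators_id: "(id_blinfun::'h::chilbert_space operator) \<in> bounded_operators"
  by (simp add: bounded_operators_def)

lemma closed_bounded_operators: "closed (bounded_operators :: 'h::chilbert_space operator set)"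
proof -
  have eq: "bounded_operators = (\<Inter>c. \<Inter>x. {T :: 'h operator. T (c *\<^sub>C x) = c *\<^sub>C T x})"
    by (auto simp: bounded_operators_def)
  show ?thesis
    unfolding eq
    by (intro closed_INT ballI closed_Collect_eq
          linear_continuous_on bounded_linear_compose[OF bounded_linear_scaleC] blinfun.bounded_linear_left)
qed

lemma adjoint_add:
  fixes S T :: "'h::chilbert_space operator"
  assumes "S \<in> bounded_operators" "T \<in> bounded_operators"
  shows "adjoint_op (S + T) = adjoint_op S + adjoint_op T"
  using assms by (intro adjoint_op_eqI bounded_operators_add adjoint_op_mem)
    (simp_all add: blinfun.add_left cinner_add_left cinner_add_right cinner_adjoint_left)

lemma adjoint_scale:
  fixes T :: "'h::chilbert_space operator"
  assumes "T \<in> bounded_operators"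
  shows "adjoint_op (scale_operator c T) = scale_operator (cnj c) (adjoint_op T)"
  using assms by (intro adjoint_op_eqI bounded_operators_scale adjoint_op_mem)
    (simp_all add: scale_operator_apply cinner_scaleC_left cinner_scaleC_right cinner_adjoint_left)

lemma adjoint_compose:
  fixes S T :: "'h::chilbert_space operator"
  assumes "S \<in> bounded_operators" "T \<in> bounded_operators"
  shows "adjoint_op (S o\<^sub>L T) = adjoint_op T o\<^sub>L adjoint_op S"
  using assms by (intro adjoint_op_eqI bounded_operators_compose adjoint_op_mem)
    (simp_all add: cinner_adjoint_left)

lemma adjoint_zero: "adjoint_op (0::'h::chilbert_space operator) = 0"
proof (rule adjoint_op_eqI[OF bounded_operators_zero])
  fix x y :: 'h
  show "cinner (blinfun_apply 0 x) y = cinner x (blinfun_apply 0 y)"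
    using cinner_diff_left[of x x y] cinner_scaleR_right[of x 0 y] by simp
qed

lemma norm_adjoint_diff_le:
  fixes S T :: "'h::chilbert_space operator"
  assumes S: "S \<in> bounded_operators" and T: "T \<in> bounded_operators"
  shows "norm (adjoint_op S - adjoint_op T) \<le> norm (S - T)"
proof -
  have D: "S - T \<in> bounded_operators"
    using S T by (simp add: bounded_operators_def blinfun.diff_left linear_diff[OF bounded_linear.linear[OF bounded_linear_scaleC]])
  have "adjoint_op S = adjoint_op ((S - T) + T)" by simp
  also have "\<dots> = adjoint_op (S - T) + adjoint_op T" by (rule adjoint_add[OF D T])
  finally show ?thesis using norm_adjoint_le[OF D] by simp
qed

text \<open>For \<open>z = x - V V\<^sup>* x\<close> idempotence gives \<open>V V\<^sup>* z = 0\<close>, hence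
  \<open>\<parallel>V\<^sup>* z\<parallel>\<^sup>2 = \<langle>z, V V\<^sup>* z\<rangle> = 0\<close>.\<close>

lemma partial_isometryI:
  fixes V :: "'h::chilbert_space operator"
  assumes V: "V \<in> bounded_operators"
    and idem: "(V o\<^sub>L adjoint_op V) o\<^sub>L (V o\<^sub>L adjoint_op V) = V o\<^sub>L adjoint_op V"
  shows "adjoint_op V o\<^sub>L (V o\<^sub>L adjoint_op V) = adjoint_op V"
    and "(V o\<^sub>L adjoint_op V) o\<^sub>L V = V"
proof -
  let ?W = "adjoint_op V"
  have "?W (V (?W x)) = ?W x" for x
  proof -
    define z where "z = x - V (?W x)"
    have "V (?W (V (?W x))) = V (?W x)"
      using arg_cong[OF idem, of "\<lambda>T. blinfun_apply T x"] by simp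
    then have "V (?W z) = 0" by (simp add: z_def blinfun.diff_right)
    then have "cinner (?W z) (?W z) = 0"
      using cinner_scaleR_right[of z 0 z] by (simp add: cinner_adjoint_left[OF V])
    then have "?W z = 0" by (simp add: cinner_same)
    then show ?thesis by (simp add: z_def blinfun.diff_right)
  qed
  then show *: "?W o\<^sub>L (V o\<^sub>L ?W) = ?W" by (intro blinfun_eqI) simp
  have W: "?W \<in> bounded_operators" by (rule adjoint_op_mem[OF V])
  show "(V o\<^sub>L ?W) o\<^sub>L V = V"
    using arg_cong[OF *, of adjoint_op]
    by (simp add: adjoint_compose adjoint_adjoint bounded_operators_compose V W)
qed

section \<open>The C*-algebra generated by a set of operators\<close>

lemma cstar_subalgebra_bounded_operators:
  "cstar_subalgebra (bounded_operators :: 'h::chilbert_space operator set)"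
  by (simp add: cstar_subalgebra_def bounded_operators_zero closed_bounded_operators
      bounded_operators_add bounded_operators_compose adjoint_op_mem bounded_operators_scale)

lemma cstar_generated_superset: "S \<subseteq> cstar_generated S"
  by (auto simp: cstar_generated_def)

text \<open>The bounded operators themselves belong to the family that is intersected; this keeps the
  intersection inside them.\<close>

lemma cstar_subalgebra_cstar_generated:
  assumes "S \<subseteq> bounded_operators"
  shows "cstar_subalgebra (cstar_generated S)"
proof -
  have "cstar_generated S \<subseteq> bounded_operators"
    using assms cstar_subalgebra_bounded_operators by (auto simp: cstar_generated_def)
  moreover have "closed (cstar_generated S)"
    unfolding cstar_generated_def by (intro closed_Inter ballI) (auto simp: cstar_subalgebra_def)
  ultimately show ?thesis
    unfolding cstar_subalgebra_def by (auto simp: cstar_generated_def cstar_subalgebra_def)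
qed

text \<open>The set \<open>{b. P b \<and> P (b\<^sup>*)}\<close> is self-adjoint by its form, and it is a C*-subalgebra as soon
  as \<open>P\<close> passes to sums, products, multiples and norm limits, because taking adjoints respects
  these operations. If the generators are closed under adjoints, they lie in it whenever they
  satisfy \<open>P\<close>.\<close>

lemma cstar_generated_induct [consumes 3, case_names generator zero add compose scale limit]:
  fixes S :: "'h::chilbert_space operator set"
  assumes S: "S \<subseteq> bounded_operators" and star: "adjoint_op ` S \<subseteq> S"
    and b: "b \<in> cstar_generated S"
    and gen: "\<And>a. a \<in> S \<Longrightarrow> P a"
    and zero: "P 0"
    and add: "\<And>a b. \<lbrakk>a \<in> cstar_generated S; b \<in> cstar_generated S; P a; P b\<rbrakk> \<Longrightarrow> P (a + b)"
    and comp: "\<And>a b. \<lbrakk>a \<in> cstar_generated S; b \<in> cstar_generated S; P a; P b\<rbrakk> \<Longrightarrow> P (a o\<^sub>L b)"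
    and scale: "\<And>c a. \<lbrakk>a \<in> cstar_generated S; P a\<rbrakk> \<Longrightarrow> P (scale_operator c a)"
    and lim: "\<And>a. \<lbrakk>a \<in> cstar_generated S;
        \<And>e. 0 < e \<Longrightarrow> \<exists>c\<in>cstar_generated S. P c \<and> norm (c - a) < e\<rbrakk> \<Longrightarrow> P a"
  shows "P b"
proof -
  let ?G = "cstar_generated S"
  define D where "D = {b \<in> ?G. P b \<and> P (adjoint_op b)}"
  have G: "cstar_subalgebra ?G" by (rule cstar_subalgebra_cstar_generated[OF S])
  have bd: "a \<in> bounded_operators" and adj: "adjoint_op a \<in> ?G" if "a \<in> ?G" for a
    using G that by (auto simp: cstar_subalgebra_def)
  have "closed D"
    unfolding closure_subset_eq[symmetric]
  proof
    fix a assume "a \<in> closure D"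
    then have app: "\<forall>e>0. \<exists>c\<in>D. dist c a < e" by (simp add: closure_approachable)
    then have "\<forall>e>0. \<exists>c\<in>?G. dist c a < e" unfolding D_def by blast
    then have a: "a \<in> ?G"
      using G closed_approachable[of ?G a] by (simp add: cstar_subalgebra_def)
    have "P a"
      by (rule lim[OF a]) (use app in \<open>auto simp: D_def dist_norm\<close>)
    moreover have "P (adjoint_op a)"
    proof (rule lim[OF adj[OF a]])
      fix e :: real assume "0 < e"
      then obtain c where "c \<in> D" "norm (c - a) < e" using app by (auto simp: dist_norm)
      then show "\<exists>c\<in>?G. P c \<and> norm (c - adjoint_op a) < e"
        using norm_adjoint_diff_le[of c a] a bd adj
        by (intro bexI[of _ "adjoint_op c"]) (auto simp: D_def)
    qed
    ultimately show "a \<in> D" using a by (simp add: D_def)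
  qed
  then have "cstar_subalgebra D"
    using G add comp scale bd adj zero unfolding cstar_subalgebra_def D_def
    by (auto simp: adjoint_add adjoint_compose adjoint_scale adjoint_adjoint adjoint_zero)
  moreover have "S \<subseteq> D"
    using gen star cstar_generated_superset by (auto simp: D_def)
  ultimately have "?G \<subseteq> D" by (auto simp: cstar_generated_def)
  then show ?thesis using b by (auto simp: D_def)
qed

section \<open>Characters\<close>

lemma character_unit:
  assumes "x \<in> max_ideal_space B" and "id_blinfun \<in> B"
  shows "x id_blinfun = 1"
proof -
  obtain a where a: "a \<in> B" "x a \<noteq> 0" using assms by (auto simp: max_ideal_space_def)
  have "id_blinfun o\<^sub>L a = a" by (rule blinfun_eqI) simp
  then have "x a = x id_blinfun * x a"
    using assms a(1) unfolding max_ideal_space_def by force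
  then show ?thesis using a(2) by simp
qed

lemma norm_scale_operator_le: "norm (scale_operator c T) \<le> cmod c * norm T"
  by (rule norm_blinfun_bound)
     (simp_all add: scale_operator_apply norm_scaleC mult.assoc mult_left_mono norm_blinfun)

text \<open>A character that were to enlarge a norm would take the value \<open>1\<close> at some strict contraction
  \<open>c\<close>. The algebra contains the fixed point \<open>s = 1 + c s\<close>, which is \<open>(1 - c)\<^sup>-\<^sup>1\<close>, and the
  character would give \<open>x s = 1 + x s\<close>.\<close>

lemma character_norm_le:
  assumes B: "cstar_subalgebra B" and id: "id_blinfun \<in> B"
    and x: "x \<in> max_ideal_space B" and b: "b \<in> B"
  shows "cmod (x b) \<le> norm b"
proof (rule ccontr)
  assume "\<not> cmod (x b) \<le> norm b"
  then have less: "norm b < cmod (x b)" by simp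
  then have pos: "0 < cmod (x b)" using norm_ge_zero[of b] by linarith
  define c where "c = scale_operator (1 / x b) b"
  have c: "c \<in> B" using B b by (simp add: c_def cstar_subalgebra_def)
  have "x c = 1"
    using x b pos by (simp add: c_def max_ideal_space_def)
  have "norm c \<le> norm b / cmod (x b)"
    using norm_scale_operator_le[of "1 / x b" b] by (simp add: c_def norm_divide)
  also have "\<dots> < 1" using less pos by simp
  finally have c1: "norm c < 1" .
  have "\<exists>!s. s \<in> B \<and> id_blinfun + (c o\<^sub>L s) = s"
  proof (rule Banach_fix[where c = "norm c"])
    show "complete B" "B \<noteq> {}"
      using B by (auto simp: cstar_subalgebra_def complete_eq_closed)
    show "(\<lambda>s. id_blinfun + (c o\<^sub>L s)) ` B \<subseteq> B"
      using B c id by (auto simp: cstar_subalgebra_def)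
    fix s t
    have "(id_blinfun + (c o\<^sub>L s)) - (id_blinfun + (c o\<^sub>L t)) = c o\<^sub>L (s - t)"
      by (rule blinfun_eqI) (simp add: blinfun.bilinear_simps)
    then show "dist (id_blinfun + (c o\<^sub>L s)) (id_blinfun + (c o\<^sub>L t)) \<le> norm c * dist s t"
      by (simp add: dist_norm norm_blinfun_compose)
  qed (use c1 in auto)
  then obtain s where s: "s \<in> B" "id_blinfun + (c o\<^sub>L s) = s" by blast
  have "c o\<^sub>L s \<in> B" using B c s(1) by (simp add: cstar_subalgebra_def)
  then have "x (id_blinfun + (c o\<^sub>L s)) = x id_blinfun + x c * x s"
    using x id c s(1) by (simp add: max_ideal_space_def)
  then have "x s = x id_blinfun + x c * x s" unfolding s(2) .
  then show False using \<open>x c = 1\<close> character_unit[OF x id] by simp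
qed

section \<open>Weak-* continuity and uniform limits\<close>

lemma topspace_weak_star_topology: "topspace (weak_star_topology B) = max_ideal_space B"
  by (auto simp: weak_star_topology_def max_ideal_space_def PiE_def)

lemma continuous_map_evaluation:
  assumes "b \<in> B"
  shows "continuous_map (weak_star_topology B) euclidean (\<lambda>x. x b)"
  unfolding weak_star_topology_def
  by (intro continuous_map_from_subtopology continuous_map_product_projection assms)

lemma continuous_map_to_euclidean_iff:
  fixes f :: "'a \<Rightarrow> 'b::metric_space"
  shows "continuous_map X euclidean f \<longleftrightarrow>
    (\<forall>x\<in>topspace X. \<forall>e>0. \<exists>V. openin X V \<and> x \<in> V \<and> (\<forall>y\<in>V. dist (f x) (f y) < e))"
  using Met_TC.continuous_map_to_metric[of X f] by simp

lemma continuous_map_mult_euclidean: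
  fixes f g :: "'a \<Rightarrow> 'b::real_normed_algebra"
  assumes "continuous_map X euclidean f" "continuous_map X euclidean g"
  shows "continuous_map X euclidean (\<lambda>x. f x * g x)"
  using assms by (simp add: continuous_map_atin tendsto_mult)

lemma continuous_map_uniform_approximation:
  fixes f :: "'a \<Rightarrow> 'b::metric_space"
  assumes "\<And>e. 0 < e \<Longrightarrow> \<exists>g. continuous_map X euclidean g \<and> (\<forall>x\<in>topspace X. dist (g x) (f x) < e)"
  shows "continuous_map X euclidean f"
  unfolding continuous_map_to_euclidean_iff
proof (intro ballI allI impI)
  fix x and e :: real assume x: "x \<in> topspace X" and "0 < e"
  then obtain g where g: "continuous_map X euclidean g" "\<And>y. y \<in> topspace X \<Longrightarrow> dist (g y) (f y) < e/3"
    using assms[of "e/3"] by auto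
  obtain V where V: "openin X V" "x \<in> V" "\<And>y. y \<in> V \<Longrightarrow> dist (g x) (g y) < e/3"
    using g(1) x \<open>0 < e\<close> unfolding continuous_map_to_euclidean_iff
    by (metis divide_pos_pos zero_less_numeral)
  have "dist (f x) (f y) < e" if "y \<in> V" for y
    using V(3)[OF that] g(2)[OF x] g(2)[of y] that openin_subset[OF V(1)]
      dist_triangle[of "f x" "f y" "g x"] dist_triangle[of "g x" "f y" "g y"]
    by (auto simp: dist_commute)
  then show "\<exists>V. openin X V \<and> x \<in> V \<and> (\<forall>y\<in>V. dist (f x) (f y) < e)" using V by blast
qed

section \<open>The iterates of the endomorphism and of its transfer operator\<close>

primrec operator_power :: "'h::chilbert_space operator \<Rightarrow> nat \<Rightarrow> 'h operator" where
  "operator_power U 0 = id_blinfun"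
| "operator_power U (Suc n) = operator_power U n o\<^sub>L U"

lemma adjoint_id: "adjoint_op id_blinfun = (id_blinfun :: 'h::chilbert_space operator)"
  by (rule adjoint_op_eqI[OF bounded_operators_id]) simp

lemma operator_power_mem: "U \<in> bounded_operators \<Longrightarrow> operator_power U n \<in> bounded_operators"
  by (induction n) (simp_all add: bounded_operators_id bounded_operators_compose)

lemma blinfun_compose_id: "id_blinfun o\<^sub>L T = T" "T o\<^sub>L id_blinfun = T"
  by (auto intro: blinfun_eqI)

lemma blinfun_compose_assoc: "(S o\<^sub>L T) o\<^sub>L R = S o\<^sub>L (T o\<^sub>L R)"
  by (rule blinfun_eqI) simp

lemma delta_star_funpow:
  assumes "U \<in> bounded_operators"
  shows "(delta_star U ^^ n) a = adjoint_op (operator_power U n) o\<^sub>L a o\<^sub>L operator_power U n"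
proof (induction n)
  case (Suc n)
  then show ?case
    using assms operator_power_mem[OF assms, of n]
    by (simp add: delta_star_def adjoint_compose blinfun_compose_assoc)
qed (simp add: adjoint_id blinfun_compose_id)

lemma delta_funpow:
  assumes "U \<in> bounded_operators"
  shows "(delta U ^^ n) a = operator_power U n o\<^sub>L a o\<^sub>L adjoint_op (operator_power U n)"
proof (induction n arbitrary: a)
  case (Suc n)
  then show ?case
    using assms operator_power_mem[OF assms, of n]
    by (simp add: delta_def adjoint_compose blinfun_compose_assoc funpow_Suc_right del: funpow.simps)
qed (simp add: adjoint_id blinfun_compose_id)

lemma delta_star_funpow_adjoint:
  assumes U: "U \<in> bounded_operators" and a: "a \<in> bounded_operators"
  shows "adjoint_op ((delta_star U ^^ n) a) = (delta_star U ^^ n) (adjoint_op a)"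
  using a adjoint_op_mem[OF a] operator_power_mem[OF U, of n] adjoint_op_mem[OF operator_power_mem[OF U, of n]]
  by (simp add: delta_star_funpow[OF U] adjoint_compose bounded_operators_compose adjoint_adjoint
      blinfun_compose_assoc)

locale partial_isometry_dynamics =
  fixes A :: "'h::chilbert_space operator set" and U :: "'h operator"
  assumes A: "cstar_subalgebra A"
    and commutative: "commutative_ops A"
    and id_mem: "id_blinfun \<in> A"
    and U: "U \<in> bounded_operators"
    and endo: "star_endomorphism A (delta U)"
    and U_U_commutant: "adjoint_op U o\<^sub>L U \<in> commutant A"
begin

abbreviation "iter n \<equiv> delta_star U ^^ n"
abbreviation "B \<equiv> coefficient_algebra A U"
abbreviation "X \<equiv> weak_star_topology B"
abbreviation "Y \<equiv> seq_topology A U"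
abbreviation "\<xi> \<equiv> xi A U"
abbreviation "V n \<equiv> operator_power U n"
abbreviation "Q \<equiv> adjoint_op U o\<^sub>L U"

lemma invariant: "\<forall>a\<in>A. delta U a \<in> A"
  using endo by (simp add: star_endomorphism_def)

lemma A_mem:
  shows "a \<in> A \<Longrightarrow> a \<in> bounded_operators"
    and "a \<in> A \<Longrightarrow> b \<in> A \<Longrightarrow> a + b \<in> A"
    and "a \<in> A \<Longrightarrow> b \<in> A \<Longrightarrow> a o\<^sub>L b \<in> A"
    and "a \<in> A \<Longrightarrow> adjoint_op a \<in> A"
    and "a \<in> A \<Longrightarrow> scale_operator c a \<in> A"
  using A by (auto simp: cstar_subalgebra_def)

lemma commute: "a \<in> A \<Longrightarrow> b \<in> A \<Longrightarrow> a o\<^sub>L b = b o\<^sub>L a"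
  using commutative by (simp add: commutative_ops_def)

lemma range_projection_mem: "V n o\<^sub>L adjoint_op (V n) \<in> A"
  using funpow_delta_mem[OF invariant id_mem, of n]
  by (simp add: delta_funpow[OF U] blinfun_compose_id)

lemma power_partial_isometry: "(V n o\<^sub>L adjoint_op (V n)) o\<^sub>L V n = V n"
proof -
  have "(delta U ^^ n) id_blinfun o\<^sub>L (delta U ^^ n) id_blinfun = (delta U ^^ n) id_blinfun"
  proof (induction n)
    case (Suc n)
    have "delta U (a o\<^sub>L b) = delta U a o\<^sub>L delta U b" if "a \<in> A" "b \<in> A" for a b
      using endo that by (simp add: star_endomorphism_def)
    then show ?case
      using Suc funpow_delta_mem[OF invariant id_mem, of n] by (metis funpow.simps(2) o_apply)
  qed (simp add: blinfun_compose_id)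
  then show ?thesis
    using partial_isometryI(2)[OF operator_power_mem[OF U]]
    by (simp add: delta_funpow[OF U] blinfun_compose_id)
qed

text \<open>The range projection \<open>V V\<^sup>*\<close> of \<open>V = U\<^sup>n\<close> is \<open>\<delta>\<^sup>n 1\<close>. It therefore commutes with \<open>a\<close>, so
  \<open>V\<^sup>* T (V V\<^sup>*) a V = V\<^sup>* T a V\<close>. The operator \<open>T\<close> is arbitrary because \<open>U\<^sup>* U\<close>, which need not
  lie in \<open>A\<close>, is one of the factors to which this is applied.\<close>

lemma iter_compose:
  assumes "a \<in> A"
  shows "iter n (T o\<^sub>L a) = iter n T o\<^sub>L iter n a"
proof (rule blinfun_eqI)
  fix y
  let ?V = "V n" and ?W = "adjoint_op (V n)"
  have "(?V o\<^sub>L ?W) o\<^sub>L a = a o\<^sub>L (?V o\<^sub>L ?W)"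
    by (rule commute[OF range_projection_mem assms])
  then have "?V (?W (a (?V y))) = a (?V (?W (?V y)))"
    by (metis blinfun_apply_blinfun_compose)
  also have "?V (?W (?V y)) = ?V y"
    using arg_cong[OF power_partial_isometry[of n], of "\<lambda>T. blinfun_apply T y"] by simp
  finally show "iter n (T o\<^sub>L a) y = (iter n T o\<^sub>L iter n a) y"
    by (simp add: delta_star_funpow[OF U])
qed

lemma U_partial_isometry: "(U o\<^sub>L adjoint_op U) o\<^sub>L U = U"
  using power_partial_isometry[of 1] by (simp add: blinfun_compose_id)

text \<open>Since \<open>U\<^sup>* U\<close> is a projection commuting with \<open>A\<close>, one has \<open>\<delta>\<^sub>* (\<delta> a) = U\<^sup>* U a\<close>, and
  \<open>U\<^sup>* U = \<delta>\<^sub>* 1\<close>. This identity is what makes \<open>\<alpha>\<close> move each coordinate to the preceding one.\<close>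

lemma iter_Suc_delta:
  assumes "a \<in> A"
  shows "iter (Suc n) (delta U a) = iter (Suc n) id_blinfun o\<^sub>L iter n a"
proof -
  have "Q o\<^sub>L a = a o\<^sub>L Q" using U_U_commutant assms by (simp add: commutant_def)
  then have "delta_star U (delta U a) = Q o\<^sub>L a"
    using U_partial_isometry unfolding delta_star_def delta_def by (metis blinfun_compose_assoc)
  moreover have "delta_star U id_blinfun = Q"
    by (simp add: delta_star_def blinfun_compose_id)
  ultimately show ?thesis
    using iter_compose[OF assms, of n Q] by (simp add: funpow_Suc_right del: funpow.simps)
qed

text \<open>The projections \<open>\<delta>\<^sub>*\<^sup>n 1\<close> decrease. This forces the nonzero coordinates of a character to
  form an initial segment.\<close>

lemma iter_Suc_id: "iter (Suc n) id_blinfun = iter (Suc n) id_blinfun o\<^sub>L iter n id_blinfun"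
  using iter_compose[OF id_mem, of n Q]
  by (simp add: funpow_Suc_right delta_star_def blinfun_compose_id del: funpow.simps)

lemma iter_add: "iter n (a + b) = iter n a + iter n b"
  by (rule blinfun_eqI) (simp add: delta_star_funpow[OF U] blinfun.bilinear_simps)

lemma iter_scale: "iter n (scale_operator c a) = scale_operator c (iter n a)"
  using adjoint_op_mem[OF operator_power_mem[OF U, of n]]
  by (intro blinfun_eqI) (simp add: delta_star_funpow[OF U] scale_operator_apply bounded_operators_def)

section \<open>The coefficient algebra\<close>

lemma generators_bounded: "(\<Union>n. iter n ` A) \<subseteq> bounded_operators"
  using A_mem(1) operator_power_mem[OF U] adjoint_op_mem[OF operator_power_mem[OF U]]
  by (auto simp: delta_star_funpow[OF U] intro!: bounded_operators_compose)

lemma generators_adjoint: "adjoint_op ` (\<Union>n. iter n ` A) \<subseteq> (\<Union>n. iter n ` A)"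
  using delta_star_funpow_adjoint[OF U] A_mem(1,4) by fastforce

lemma cstar_subalgebra_coefficient_algebra: "cstar_subalgebra B"
  unfolding coefficient_algebra_def
  by (rule cstar_subalgebra_cstar_generated[OF generators_bounded])

lemma iter_mem: "a \<in> A \<Longrightarrow> iter n a \<in> B"
  using cstar_generated_superset unfolding coefficient_algebra_def by fast

lemma B_id: "id_blinfun \<in> B"
  using iter_mem[OF id_mem, of 0] by simp

lemma B_mem:
  shows "a \<in> B \<Longrightarrow> b \<in> B \<Longrightarrow> a + b \<in> B"
    and "a \<in> B \<Longrightarrow> b \<in> B \<Longrightarrow> a o\<^sub>L b \<in> B"
    and "a \<in> B \<Longrightarrow> scale_operator c a \<in> B"
    and "0 \<in> B"
  using cstar_subalgebra_coefficient_algebra by (auto simp: cstar_subalgebra_def)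

lemmas B_induct [consumes 1, case_names generator zero add compose scale limit] =
  cstar_generated_induct[OF generators_bounded generators_adjoint, folded coefficient_algebra_def]

context
  fixes x
  assumes x: "x \<in> max_ideal_space B"
begin

lemma character_simps:
  shows "a \<in> B \<Longrightarrow> b \<in> B \<Longrightarrow> x (a + b) = x a + x b"
    and "a \<in> B \<Longrightarrow> b \<in> B \<Longrightarrow> x (a o\<^sub>L b) = x a * x b"
    and "a \<in> B \<Longrightarrow> x (scale_operator c a) = c * x a"
  using x by (auto simp: max_ideal_space_def)

lemma character_diff_le:
  assumes "a \<in> B" "b \<in> B"
  shows "cmod (x a - x b) \<le> norm (a - b)"
proof -
  have m: "scale_operator (-1) b = - b"
    using scaleC_of_real[of "-1"] by (intro blinfun_eqI) (simp add: scale_operator_apply blinfun.minus_left)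
  have "x (a + scale_operator (-1) b) = x a - x b"
    using assms B_mem by (simp add: character_simps)
  moreover have "a + scale_operator (-1) b \<in> B" using assms B_mem by simp
  ultimately show ?thesis
    using character_norm_le[OF cstar_subalgebra_coefficient_algebra B_id x, of "a + scale_operator (-1) b"]
    by (simp add: m)
qed

end

lemma character_zero: "x \<in> max_ideal_space B \<Longrightarrow> x 0 = 0"
  using character_simps(1)[of x 0 0] B_mem(4) by simp

section \<open>Coordinate sequences of characters\<close>

lemma xi_apply: "a \<in> A \<Longrightarrow> \<xi> x n a = x (iter n a)"
  by (simp add: xi_def)

context
  fixes x
  assumes x: "x \<in> max_ideal_space B"
begin

lemma iter_id_zero_or_one: "x (iter n id_blinfun) = 0 \<or> x (iter n id_blinfun) = 1"
proof -
  have "x (iter n id_blinfun) = x (iter n id_blinfun) * x (iter n id_blinfun)"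
    using iter_compose[OF id_mem, of n id_blinfun] character_simps(2)[OF x] iter_mem[OF id_mem, of n]
    by (metis blinfun_compose_id(1))
  then show ?thesis by simp
qed

lemma iter_id_antimono: "x (iter m id_blinfun) = 1 \<Longrightarrow> n \<le> m \<Longrightarrow> x (iter n id_blinfun) = 1"
proof (induction m)
  case (Suc m)
  have "x (iter (Suc m) id_blinfun) = x (iter (Suc m) id_blinfun) * x (iter m id_blinfun)"
    using iter_Suc_id[of m] character_simps(2)[OF x] iter_mem[OF id_mem] by metis
  then have "x (iter m id_blinfun) = 1" using Suc.prems(1) by simp
  then show ?case using Suc by (cases "n = Suc m") auto
qed simp

text \<open>The value of \<open>x\<close> at \<open>\<delta>\<^sub>*\<^sup>n 1\<close> is the value of the \<open>n\<close>-th coordinate at the unit, and so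
  it tells whether this coordinate is a character or zero.\<close>

lemma xi_zero:
  assumes "x (iter n id_blinfun) = 0"
  shows "\<xi> x n = zero_functional A"
proof -
  have "x (iter n a) = 0" if "a \<in> A" for a
    using iter_compose[OF that, of n id_blinfun] character_simps(2)[OF x] iter_mem id_mem that assms
    by (metis blinfun_compose_id(1) mult_zero_left)
  then show ?thesis by (auto simp: xi_def zero_functional_def restrict_def)
qed

lemma xi_max_ideal_space:
  assumes "x (iter n id_blinfun) = 1"
  shows "\<xi> x n \<in> max_ideal_space A"
  using assms id_mem A_mem iter_mem
  by (auto simp: max_ideal_space_def xi_apply iter_compose iter_add iter_scale character_simps[OF x]
      intro!: bexI[of _ id_blinfun]) (simp add: xi_def)

lemma alpha_xi:
  assumes "x (iter (Suc n) id_blinfun) = 1"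
  shows "alpha A U (\<xi> x (Suc n)) = \<xi> x n"
proof
  fix a
  show "alpha A U (\<xi> x (Suc n)) a = \<xi> x n a"
  proof (cases "a \<in> A")
    case True
    then have "alpha A U (\<xi> x (Suc n)) a = x (iter (Suc n) (delta U a))"
      using invariant by (simp add: alpha_def xi_apply del: funpow.simps)
    also have "\<dots> = x (iter n a)"
      unfolding iter_Suc_delta[OF True]
      using assms iter_mem[OF True] iter_mem[OF id_mem] by (simp add: character_simps[OF x] del: funpow.simps)
    finally show ?thesis using True by (simp add: xi_apply)
  qed (simp add: alpha_def xi_def)
qed

lemma xi_Delta_iter: "x (iter n id_blinfun) = 1 \<Longrightarrow> \<xi> x n \<in> Delta_iter A U n"
proof (induction n)
  case (Suc n)
  have one: "x (iter n id_blinfun) = 1" by (rule iter_id_antimono[OF Suc.prems]) simp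
  have d: "delta U id_blinfun = U o\<^sub>L adjoint_op U"
    by (simp add: delta_def blinfun_compose_id)
  have "\<xi> x (Suc n) (U o\<^sub>L adjoint_op U) = alpha A U (\<xi> x (Suc n)) id_blinfun"
    using id_mem by (simp add: alpha_def d)
  also have "\<dots> = 1"
    using id_mem one by (simp add: alpha_xi[OF Suc.prems] xi_apply)
  finally show ?case
    using xi_max_ideal_space[OF Suc.prems] Suc.IH[OF one] by (simp add: Delta_def alpha_xi[OF Suc.prems])
qed (simp add: xi_max_ideal_space)

lemma Delta_iter_iter_id: "\<xi> x n \<in> Delta_iter A U n \<Longrightarrow> x (iter n id_blinfun) = 1"
  using Delta_iter_ne_zero xi_zero iter_id_zero_or_one by blast

lemma xi_M_fin_iff:
  "\<xi> x \<in> M_fin A U N \<longleftrightarrow> x (iter N id_blinfun) = 1 \<and> x (iter (Suc N) id_blinfun) = 0"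
proof
  assume M: "\<xi> x \<in> M_fin A U N"
  then have "\<xi> x N \<in> Delta_iter A U N" "\<xi> x (Suc N) = zero_functional A"
    by (auto simp: M_fin_def)
  moreover from this(2) have "\<xi> x (Suc N) id_blinfun = 0"
    using id_mem by (simp add: zero_functional_def)
  ultimately show "x (iter N id_blinfun) = 1 \<and> x (iter (Suc N) id_blinfun) = 0"
    using Delta_iter_iter_id xi_apply[OF id_mem, of x "Suc N"] by simp
next
  assume R: "x (iter N id_blinfun) = 1 \<and> x (iter (Suc N) id_blinfun) = 0"
  have one: "x (iter n id_blinfun) = 1" if "n \<le> N" for n
    using R iter_id_antimono that by blast
  have "x (iter n id_blinfun) = 0" if "N < n" for n
    using R iter_id_antimono[of n "Suc N"] iter_id_zero_or_one[of n] that by auto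
  moreover have "alpha A U (\<xi> x n) = \<xi> x (n - 1)" if "n \<in> {1..N}" for n
    using alpha_xi[of "n - 1"] one[of n] that by (cases n) (auto simp del: funpow.simps)
  ultimately show "\<xi> x \<in> M_fin A U N"
    using one xi_Delta_iter xi_zero by (simp add: M_fin_def)
qed

lemma xi_M_inf_iff: "\<xi> x \<in> M_inf A U \<longleftrightarrow> (\<forall>n. x (iter n id_blinfun) = 1)"
proof
  assume one: "\<forall>n. x (iter n id_blinfun) = 1"
  have "alpha A U (\<xi> x n) = \<xi> x (n - 1)" if "1 \<le> n" for n
    using alpha_xi[of "n - 1"] one that by (cases n) (auto simp del: funpow.simps)
  then show "\<xi> x \<in> M_inf A U" using one xi_Delta_iter by (simp add: M_inf_def)
qed (use Delta_iter_iter_id in \<open>auto simp: M_inf_def\<close>)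

text \<open>The neighbourhoods of points of \<open>M\<^sub>\<infinity>\<close> live on these tails of the stratification. A sequence
  outside \<open>M\<^sub>\<infinity>\<close> lies in \<open>M\<^sub>N\<close>, where \<open>N + 1\<close> is the first index at which the value at the unit
  drops to \<open>0\<close>.\<close>

lemma xi_tail_iff:
  "\<xi> x \<in> (\<Union>N\<in>{n..}. M_fin A U N) \<union> M_inf A U \<longleftrightarrow> x (iter n id_blinfun) = 1"
proof
  assume one: "x (iter n id_blinfun) = 1"
  show "\<xi> x \<in> (\<Union>N\<in>{n..}. M_fin A U N) \<union> M_inf A U"
  proof (cases "\<forall>m. x (iter m id_blinfun) = 1")
    case False
    define K where "K = (LEAST m. x (iter m id_blinfun) \<noteq> 1)"
    have K: "x (iter K id_blinfun) \<noteq> 1"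
      unfolding K_def using False LeastI_ex[of "\<lambda>m. x (iter m id_blinfun) \<noteq> 1"] by blast
    then have nK: "n < K"
      using iter_id_antimono[OF one, of K] by (meson linorder_not_less)
    then obtain N where N: "K = Suc N" by (cases K) auto
    have "x (iter N id_blinfun) = 1"
      using not_less_Least[of N "\<lambda>m. x (iter m id_blinfun) \<noteq> 1"] N K_def by auto
    then have "\<xi> x \<in> M_fin A U N"
      using K iter_id_zero_or_one[of K] N xi_M_fin_iff by simp
    then show ?thesis using nK N by auto
  qed (simp add: xi_M_inf_iff)
next
  assume "\<xi> x \<in> (\<Union>N\<in>{n..}. M_fin A U N) \<union> M_inf A U"
  then show "x (iter n id_blinfun) = 1"
    using xi_M_fin_iff xi_M_inf_iff iter_id_antimono by auto
qed

lemma xi_seq_space: "\<xi> x \<in> seq_space A U"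
  using xi_tail_iff[of 0] character_unit[OF x B_id] by (auto simp: seq_space_def)

end

section \<open>The topologies agree\<close>

lemma xi_inj: "inj_on \<xi> (max_ideal_space B)"
proof (rule inj_onI)
  fix x y assume x: "x \<in> max_ideal_space B" and y: "y \<in> max_ideal_space B" and eq: "\<xi> x = \<xi> y"
  have "x b = y b" if "b \<in> B" for b
    using that
  proof (induction rule: B_induct)
    case (generator g)
    then show ?case using eq by (auto simp flip: xi_apply)
  next
    case (limit a)
    have "cmod (x a - y a) \<le> 0 + e" if e: "0 < e" for e
    proof -
      obtain c where c: "c \<in> B" "x c = y c" "norm (c - a) < e/2"
        using limit(2)[of "e/2"] e by auto
      have "cmod (x a - y a) \<le> cmod (x c - x a) + cmod (y c - y a)"
        using norm_triangle_ineq4[of "y c - y a" "x c - x a"] c(2) by simp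
      then show ?thesis
        using character_diff_le[OF x c(1) limit(1)] character_diff_le[OF y c(1) limit(1)] c(3) by simp
    qed
    then have "cmod (x a - y a) \<le> 0" by (rule field_le_epsilon)
    then show ?case by simp
  qed (simp_all add: character_simps[OF x] character_simps[OF y] character_zero x y)
  then show "x = y"
    using x y by (intro extensionalityI[of _ B]) (auto simp: max_ideal_space_def)
qed

lemma openin_evaluation:
  assumes "b \<in> B" "open W"
  shows "openin X {x \<in> max_ideal_space B. x b \<in> W}"
  using openin_continuous_map_preimage[OF continuous_map_evaluation[OF assms(1)], of W] assms(2)
  by (simp add: topspace_weak_star_topology)

text \<open>Characters are \<open>0\<close> or \<open>1\<close> at \<open>\<delta>\<^sub>*\<^sup>n 1\<close>, so prescribing one of these values is an open
  condition. Two consecutive values single out \<open>M\<^sub>N\<close>, and one value singles out a tail.\<close>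

lemma openin_iter_id:
  "openin X {x \<in> max_ideal_space B. x (iter n id_blinfun) = 1}"
  "openin X {x \<in> max_ideal_space B. x (iter n id_blinfun) = 0}"
proof -
  have "{x \<in> max_ideal_space B. x (iter n id_blinfun) = 1} = {x \<in> max_ideal_space B. x (iter n id_blinfun) \<in> - {0}}"
    "{x \<in> max_ideal_space B. x (iter n id_blinfun) = 0} = {x \<in> max_ideal_space B. x (iter n id_blinfun) \<in> - {1}}"
    using iter_id_zero_or_one[of _ n] by force+
  then show "openin X {x \<in> max_ideal_space B. x (iter n id_blinfun) = 1}"
    "openin X {x \<in> max_ideal_space B. x (iter n id_blinfun) = 0}"
    using openin_evaluation[OF iter_mem[OF id_mem], of "- {0}"]
      openin_evaluation[OF iter_mem[OF id_mem], of "- {1}"] by (simp_all add: open_Compl)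
qed

lemma openin_finite_evaluations:
  assumes "finite F" "F \<subseteq> A"
  shows "openin X {x \<in> max_ideal_space B. \<forall>a\<in>F. cmod (z a - \<xi> x n a) < e}"
  using assms
proof (induction F rule: finite_induct)
  case empty
  then show ?case using openin_topspace[of X] by (simp add: topspace_weak_star_topology)
next
  case (insert a F)
  have "{x \<in> max_ideal_space B. \<forall>a\<in>insert a F. cmod (z a - \<xi> x n a) < e} =
    {x \<in> max_ideal_space B. x (iter n a) \<in> ball (z a) e} \<inter>
    {x \<in> max_ideal_space B. \<forall>a\<in>F. cmod (z a - \<xi> x n a) < e}"
    using insert.prems by (auto simp: dist_norm xi_apply)
  then show ?case
    using insert openin_evaluation[OF iter_mem open_ball] by (simp add: openin_Int)
qed

lemma openin_preimage_nbhd_base: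
  assumes "W \<in> nbhd_base A U z"
  shows "openin X {x \<in> max_ideal_space B. \<xi> x \<in> W}"
proof -
  let ?M = "max_ideal_space B"
  consider (fin) N F e where "W = nbhd_fin A U N z F e" "finite F" "F \<subseteq> A"
    | (inf) F n e where "W = nbhd_inf A U z F n e" "finite F" "F \<subseteq> A"
    using assms unfolding nbhd_base_def by auto
  then show ?thesis
  proof cases
    case fin
    have "{x \<in> ?M. \<xi> x \<in> W} = {x \<in> ?M. x (iter N id_blinfun) = 1} \<inter>
      {x \<in> ?M. x (iter (Suc N) id_blinfun) = 0} \<inter> {x \<in> ?M. \<forall>a\<in>F. cmod (z N a - \<xi> x N a) < e}"
      unfolding fin(1) nbhd_fin_def using xi_M_fin_iff[of _ N] by auto
    then show ?thesis
      by (simp only: openin_Int openin_iter_id openin_finite_evaluations[OF fin(2,3)])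
  next
    case inf
    have "\<xi> x \<in> W \<longleftrightarrow> x (iter n id_blinfun) = 1 \<and> (\<forall>a\<in>F. cmod (z n a - \<xi> x n a) < e)"
      if "x \<in> ?M" for x
      unfolding inf(1) nbhd_inf_def mem_Collect_eq xi_tail_iff[OF that] by (rule refl)
    then have "{x \<in> ?M. \<xi> x \<in> W} = {x \<in> ?M. x (iter n id_blinfun) = 1} \<inter>
      {x \<in> ?M. \<forall>a\<in>F. cmod (z n a - \<xi> x n a) < e}"
      by (intro set_eqI) (simp only: mem_Collect_eq Int_iff, metis)
    then show ?thesis
      by (simp only: openin_Int openin_iter_id openin_finite_evaluations[OF inf(2,3)])
  qed
qed

lemma continuous_map_xi: "continuous_map X Y \<xi>"
  unfolding continuous_map_def topspace_weak_star_topology topspace_seq_topology[OF invariant]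
proof (intro conjI allI impI)
  show "\<xi> \<in> max_ideal_space B \<rightarrow> seq_space A U" using xi_seq_space by blast
  fix W assume W: "openin Y W"
  show "openin X {x \<in> max_ideal_space B. \<xi> x \<in> W}"
  proof (subst openin_subopen, intro ballI)
    fix x assume "x \<in> {x \<in> max_ideal_space B. \<xi> x \<in> W}"
    then obtain Z where "Z \<in> nbhd_base A U (\<xi> x)" "Z \<subseteq> W" "x \<in> max_ideal_space B"
      using W openin_seq_topology[OF invariant] by auto
    then show "\<exists>T. openin X T \<and> x \<in> T \<and> T \<subseteq> {x \<in> max_ideal_space B. \<xi> x \<in> W}"
      using openin_preimage_nbhd_base[of Z "\<xi> x"] nbhd_base_self[of Z A U "\<xi> x"]
      by (intro exI[of _ "{y \<in> max_ideal_space B. \<xi> y \<in> Z}"]) blast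
  qed
qed

text \<open>On \<open>M\<^sub>N\<close> the coordinates up to \<open>N\<close> are images of the \<open>N\<close>-th one under powers of \<open>\<alpha>\<close>, and the
  later ones vanish.\<close>

lemma continuous_map_coordinate:
  assumes a: "a \<in> A"
  shows "continuous_map Y euclidean (\<lambda>z. z n a)"
  unfolding continuous_map_to_euclidean_iff topspace_seq_topology[OF invariant]
proof (intro ballI allI impI)
  fix z and e :: real assume z: "z \<in> seq_space A U" and e: "0 < e"
  have "\<exists>W\<in>nbhd_base A U z. \<forall>y\<in>W. dist (z n a) (y n a) < e"
  proof -
    consider (inf) "z \<in> M_inf A U" | (le) N where "z \<in> M_fin A U N" "n \<le> N"
      | (gt) N where "z \<in> M_fin A U N" "N < n"
      using z unfolding seq_space_def by (metis UN_E Un_iff linorder_not_less)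
    then show ?thesis
    proof cases
      case inf
      have "nbhd_inf A U z {a} n e \<in> nbhd_base A U z"
        using nbhd_base_inf[OF inf] a e by blast
      then show ?thesis by (rule bexI[rotated]) (simp add: nbhd_inf_def dist_norm)
    next
      case le
      let ?b = "(delta U ^^ (N - n)) a"
      have "nbhd_fin A U N z {?b} e \<in> nbhd_base A U z"
        using nbhd_base_fin[OF le(1)] funpow_delta_mem[OF invariant a] e by blast
      moreover have shift: "y n a = y N ?b" if "y \<in> M_fin A U N" for y
        using coordinate_shift_seq[OF invariant a le(2), of y] that by blast
      have "dist (z n a) (y n a) < e" if y: "y \<in> nbhd_fin A U N z {?b} e" for y
      proof -
        have "y \<in> M_fin A U N" using y by (simp add: nbhd_fin_def)
        then show ?thesis
          using y by (simp add: shift[OF le(1)] shift[of y] nbhd_fin_def dist_norm)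
      qed
      ultimately show ?thesis by blast
    next
      case gt
      have "nbhd_fin A U N z {} 1 \<in> nbhd_base A U z"
        using nbhd_base_fin[OF gt(1)] zero_less_one by blast
      moreover have "y n = zero_functional A" if "y \<in> M_fin A U N" for y
        using that gt(2) by (simp add: M_fin_def)
      ultimately show ?thesis
        using gt(1) e by (intro bexI[of _ "nbhd_fin A U N z {} 1"]) (auto simp: nbhd_fin_def)
    qed
  qed
  then show "\<exists>W. openin Y W \<and> z \<in> W \<and> (\<forall>y\<in>W. dist (z n a) (y n a) < e)"
    by (meson openin_nbhd_base[OF invariant] nbhd_base_self)
qed

definition "image_topology = subtopology Y (\<xi> ` max_ideal_space B)"
definition "xi_inverse = inv_into (max_ideal_space B) \<xi>"

lemma topspace_image_topology: "topspace image_topology = \<xi> ` max_ideal_space B"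
  using xi_seq_space by (auto simp: image_topology_def topspace_seq_topology[OF invariant])

lemma xi_inverse_mem: "z \<in> \<xi> ` max_ideal_space B \<Longrightarrow> xi_inverse z \<in> max_ideal_space B"
  and xi_xi_inverse: "z \<in> \<xi> ` max_ideal_space B \<Longrightarrow> \<xi> (xi_inverse z) = z"
  by (auto simp: xi_inverse_def inv_into_into f_inv_into_f)

text \<open>The elements of the coefficient algebra whose Gelfand transform is continuous for the
  topology of coordinate sequences form a closed subalgebra, characters being contractive. It
  contains the generators, because evaluation at \<open>\<delta>\<^sub>*\<^sup>n a\<close> is a coordinate.\<close>

lemma continuous_map_gelfand_inverse:
  assumes "b \<in> B"
  shows "continuous_map image_topology euclidean (\<lambda>z. xi_inverse z b)"
  using assms
proof (induction rule: B_induct)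
  case (generator g)
  then obtain n a where g: "a \<in> A" "g = iter n a" by auto
  have "continuous_map image_topology euclidean (\<lambda>z. z n a)"
    unfolding image_topology_def
    by (intro continuous_map_from_subtopology continuous_map_coordinate g)
  moreover have "z n a = xi_inverse z g" if "z \<in> topspace image_topology" for z
    using xi_xi_inverse[of z] that g by (metis topspace_image_topology xi_apply)
  ultimately show ?case by (rule continuous_map_eq)
next
  case zero
  show ?case
    by (rule continuous_map_eq[of _ _ "\<lambda>_. 0"])
       (simp_all add: topspace_image_topology xi_inverse_mem character_zero)
next
  case (add a b)
  show ?case
    by (rule continuous_map_eq[OF continuous_map_add[OF add(3,4)]])
       (simp add: topspace_image_topology xi_inverse_mem character_simps add)
next
  case (compose a b)
  show ?case
    by (rule continuous_map_eq[OF continuous_map_mult_euclidean[OF compose(3,4)]])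
       (simp add: topspace_image_topology xi_inverse_mem character_simps compose)
next
  case (scale c a)
  show ?case
    by (rule continuous_map_eq[OF continuous_map_mult_euclidean[OF continuous_map_canonical_const[of _ c] scale(2)]])
       (simp add: topspace_image_topology xi_inverse_mem character_simps scale)
next
  case (limit a)
  show ?case
  proof (rule continuous_map_uniform_approximation)
    fix e :: real assume "0 < e"
    then obtain c where c: "c \<in> B" "continuous_map image_topology euclidean (\<lambda>z. xi_inverse z c)"
      "norm (c - a) < e"
      using limit(2) by blast
    have "dist (xi_inverse z c) (xi_inverse z a) < e" if "z \<in> topspace image_topology" for z
      using character_diff_le[OF xi_inverse_mem c(1) limit(1), of z] c(3) that
      by (simp add: topspace_image_topology dist_norm)
    then show "\<exists>g. continuous_map image_topology euclidean g \<and>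
        (\<forall>z\<in>topspace image_topology. dist (g z) (xi_inverse z a) < e)"
      using c(2) by blast
  qed
qed

lemma continuous_map_xi_inverse: "continuous_map image_topology X xi_inverse"
  unfolding weak_star_topology_def
proof (rule continuous_map_into_subtopology)
  show "xi_inverse \<in> topspace image_topology \<rightarrow> max_ideal_space B"
    using xi_inverse_mem by (auto simp: topspace_image_topology)
  then have "xi_inverse ` topspace image_topology \<subseteq> extensional B"
    by (auto simp: max_ideal_space_def)
  then show "continuous_map image_topology (product_topology (\<lambda>_. euclidean) B) xi_inverse"
    using continuous_map_gelfand_inverse by (simp add: continuous_map_componentwise image_subset_iff)
qed

lemma embedding_map_xi: "embedding_map X Y \<xi>"
proof -
  have "homeomorphic_maps X image_topology \<xi> xi_inverse"
    unfolding homeomorphic_maps_def topspace_weak_star_topology topspace_image_topology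
  proof (intro conjI ballI)
    show "continuous_map X image_topology \<xi>"
      unfolding image_topology_def
      by (rule continuous_map_into_subtopology[OF continuous_map_xi]) (auto simp: topspace_weak_star_topology)
    show "xi_inverse (\<xi> x) = x" if "x \<in> max_ideal_space B" for x
      unfolding xi_inverse_def by (rule inv_into_f_f[OF xi_inj that])
  qed (simp_all add: continuous_map_xi_inverse xi_xi_inverse)
  then show ?thesis
    unfolding embedding_map_def homeomorphic_map_maps topspace_weak_star_topology image_topology_def
    by blast
qed

end

theorem theorem3p1:
  fixes A :: "'h::chilbert_space operator set" and U :: "'h operator"
  assumes "cstar_subalgebra A"
    and "commutative_ops A"
    and "id_blinfun \<in> A"
    and "U \<in> bounded_operators"
    and "star_endomorphism A (delta U)"
    and "adjoint_op U o\<^sub>L U \<in> commutant A"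
  shows "embedding_map (weak_star_topology (coefficient_algebra A U)) (seq_topology A U) (xi A U)"
proof -
  interpret partial_isometry_dynamics A U
    by (rule partial_isometry_dynamics.intro) (fact assms)+
  show ?thesis by (rule embedding_map_xi)
qed

end
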